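(* Let $1\le r\le n$ with $r$ odd. The Charney-Davis quantity $(-1)^{\frac{r-1}{2}}H\big(A(U_{n,r}),-1\big)$ of the Chow ring of the uniform matroid $U_{n,r}$ equals \[ (-1)^{\frac{r-1}{2}}\sum_{k=0}^{\frac{r-1}{2}}\binom{n}{2k}E_{2k}, \] where the secant numbers $E_{2\ell}$ are defined by $\operatorname{sech}(t)=\sum_{\ell\ge0}E_{2\ell}\frac{t^{2\ell}}{(2\ell)!}$; equivalently, $H\big(A(U_{n,r}),-1\big)=\sum_{k=0}^{\frac{r-1}{2}}\binom{n}{2k}E_{2k}$.
   Context: The uniform matroid $U_{n,r}$ on $[n]$ has independent sets all subsets of size at most $r$; its lattice of flats consists of subsets of $[n]$ of size at most $r-1$ together with $[n]$. Chow ring: for a finite ranked lattice $L$ with minimum $\bot$, $A(L)=\mathbb{Z}[x_F : F\in L\setminus\{\bot\}]/I$ with $I$ generated by $x_Fx_G$ for incomparable $F,G$ and by $\sum_{F\ge a}x_F$ for each atom $a$; $A(U_{n,r})$ is the Chow ring of the lattice of flats, with Hilbert series $H(A(U_{n,r}),t)=\sum_d\operatorname{rank}_{\mathbb{Z}}A_d\,t^d$. *)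

theory Defs
  imports "HOL-Computational_Algebra.Formal_Power_Series"
begin

text \<open>A finite ranked lattice is given as a finite family L of sets ordered by
inclusion, with minimum element bt.  Polynomials in the variables x_F
(F in L - {bt}) with integer coefficients are represented as functions from
monomials (multisets of variables) to int with finite support.\<close>

definition chow_vars :: "'a set set \<Rightarrow> 'a set \<Rightarrow> 'a set set" where
  "chow_vars L bt = L - {bt}"

definition lattice_atoms :: "'a set set \<Rightarrow> 'a set \<Rightarrow> 'a set set" where
  "lattice_atoms L bt = {a \<in> L. a \<noteq> bt \<and> \<not> (\<exists>G\<in>L. bt \<subset> G \<and> G \<subset> a)}"

definition is_poly :: "'a set set \<Rightarrow> 'a set \<Rightarrow> ('a set multiset \<Rightarrow> int) \<Rightarrow> bool" where
  "is_poly L bt f \<longleftrightarrow> finite {m. f m \<noteq> 0} \<and>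
     (\<forall>m. f m \<noteq> 0 \<longrightarrow> set_mset m \<subseteq> chow_vars L bt)"

definition homog :: "nat \<Rightarrow> ('a set multiset \<Rightarrow> int) \<Rightarrow> bool" where
  "homog d f \<longleftrightarrow> (\<forall>m. f m \<noteq> 0 \<longrightarrow> size m = d)"

definition mono_mult :: "'a set multiset \<Rightarrow> ('a set multiset \<Rightarrow> int) \<Rightarrow> ('a set multiset \<Rightarrow> int)" where
  "mono_mult m f = (\<lambda>m'. if m \<subseteq># m' then f (m' - m) else 0)"

definition monomial_poly :: "'a set multiset \<Rightarrow> ('a set multiset \<Rightarrow> int)" where
  "monomial_poly m = (\<lambda>m'. if m' = m then 1 else 0)"

definition chow_gens :: "'a set set \<Rightarrow> 'a set \<Rightarrow> ('a set multiset \<Rightarrow> int) set" where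
  "chow_gens L bt =
     {monomial_poly {#F, G#} | F G. F \<in> chow_vars L bt \<and> G \<in> chow_vars L bt \<and>
                                  \<not> F \<subseteq> G \<and> \<not> G \<subseteq> F}
   \<union> {(\<lambda>m. if \<exists>F. m = {#F#} \<and> F \<in> chow_vars L bt \<and> a \<subseteq> F then 1 else 0) | a.
        a \<in> lattice_atoms L bt}"

inductive_set zspan :: "('b \<Rightarrow> int) set \<Rightarrow> ('b \<Rightarrow> int) set" for G where
  zero: "(\<lambda>_. 0) \<in> zspan G"
| gen: "g \<in> G \<Longrightarrow> g \<in> zspan G"
| add: "f \<in> zspan G \<Longrightarrow> g \<in> zspan G \<Longrightarrow> (\<lambda>x. f x + g x) \<in> zspan G"
| neg: "f \<in> zspan G \<Longrightarrow> (\<lambda>x. - f x) \<in> zspan G"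

definition chow_ideal :: "'a set set \<Rightarrow> 'a set \<Rightarrow> ('a set multiset \<Rightarrow> int) set" where
  "chow_ideal L bt = zspan {mono_mult m g | m g. set_mset m \<subseteq> chow_vars L bt \<and> g \<in> chow_gens L bt}"

text \<open>A finite set S of degree-d polynomials is Z-linearly independent in the
  quotient A_d = (degree d polynomials) / (I intersected with degree d).\<close>
definition indep_mod_ideal :: "'a set set \<Rightarrow> 'a set \<Rightarrow> nat \<Rightarrow> ('a set multiset \<Rightarrow> int) set \<Rightarrow> bool" where
  "indep_mod_ideal L bt d S \<longleftrightarrow> finite S \<and> (\<forall>s\<in>S. is_poly L bt s \<and> homog d s) \<and>
     (\<forall>c :: ('a set multiset \<Rightarrow> int) \<Rightarrow> int.
        (\<lambda>m. \<Sum>s\<in>S. c s * s m) \<in> chow_ideal L bt \<longrightarrow> (\<forall>s\<in>S. c s = 0))"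

definition chow_rank :: "'a set set \<Rightarrow> 'a set \<Rightarrow> nat \<Rightarrow> nat" where
  "chow_rank L bt d = Max {card S | S. indep_mod_ideal L bt d S}"

definition chow_hilbert :: "'a set set \<Rightarrow> 'a set \<Rightarrow> int \<Rightarrow> int" where
  "chow_hilbert L bt t = (\<Sum>d\<in>{d. chow_rank L bt d \<noteq> 0}. int (chow_rank L bt d) * t ^ d)"

definition uniform_flats :: "nat \<Rightarrow> nat \<Rightarrow> nat set set" where
  "uniform_flats n r = {S. S \<subseteq> {1..n} \<and> card S \<le> r - 1} \<union> {{1..n}}"

definition fps_cosh_real :: "real fps" where
  "fps_cosh_real = (fps_exp 1 + fps_exp (-1)) / 2"

definition secant_number :: "nat \<Rightarrow> real" where
  "secant_number k = fact k * (fps_nth (inverse fps_cosh_real) k)"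

end

theory Submission
  imports Defs "HOL-Library.Poly_Mapping"
begin

text \<open>
  The monomials \<open>x\<^bsub>F\<^sub>1\<^esub>^a\<^sub>1 \<dots> x\<^bsub>F\<^sub>k\<^esub>^a\<^sub>k\<close> of Feichtner and Yuzvinsky, on chains of flats
  \<open>F\<^sub>1 \<subset> \<dots> \<subset> F\<^sub>k\<close> with exponents \<open>a\<^sub>i\<close> strictly between 0 and the rank gap below \<open>F\<^sub>i\<close>, form a
  basis of the Chow ring. At \<open>t = -1\<close> the sum of \<open>t^a\<^sub>i\<close> over the admissible exponents is \<open>-1\<close> or
  \<open>0\<close> according to the parity of the gap, and the resulting signed count of the chains ending in a
  given proper flat satisfies the recurrence of the secant numbers; for \<open>r\<close> odd the chains ending in
  the ground set contribute nothing.

  These monomials span because \<open>x\<^bsub>F'\<^esub> y\<^sub>F^(rk F - rk F')\<close>, where \<open>y\<^sub>F\<close> is the sum of the \<open>x\<^sub>G\<close> with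
  \<open>G \<supseteq> F\<close>, lies in the ideal for flats \<open>F' \<subset> F\<close>, which rewrites every other monomial into monomials
  on larger flats.

  For independence, pass to the variables \<open>h\<^sub>F = - y\<^sub>F\<close>. In these, the ideal is generated by the
  \<open>h\<^sub>a\<close> with \<open>a\<close> an atom and the products \<open>(h\<^sub>F - h\<^sub>U) (h\<^sub>G - h\<^sub>U)\<close>, where \<open>U\<close> is the join of \<open>F\<close> and
  \<open>G\<close>. By submodularity of the rank, it is killed by the functionals mapping a monomial to 1 or 0
  according to a dragon Hall-Rado condition (Postnikov; Backman, Eur and Simpson). Cutting the
  lattice along the chain of a basis monomial \<open>b\<close>, with ranks truncated by the exponents of \<open>b\<close>,
  gives one such functional for each \<open>b\<close>, and the matrix of these functionals on the basis monomials
  of a fixed degree is triangular with diagonal entries 1 or \<open>-1\<close>.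
\<close>

subsection \<open>Secant numbers\<close>

lemma sum_subsets_by_card:
  fixes h :: "nat \<Rightarrow> real"
  assumes "finite A"
  shows "(\<Sum>G | G \<subseteq> A \<and> card G \<le> k. h (card G)) = (\<Sum>j\<le>k. real (card A choose j) * h j)"
proof -
  have fin: "finite {G. G \<subseteq> A \<and> card G \<le> k}"
    using assms by auto
  have "(\<Sum>G | G \<subseteq> A \<and> card G \<le> k. h (card G))
      = (\<Sum>j\<le>k. \<Sum>G | G \<in> {G. G \<subseteq> A \<and> card G \<le> k} \<and> card G = j. h (card G))"
    by (rule sum.group[symmetric]) (use fin in auto)
  also have "\<dots> = (\<Sum>j\<le>k. real (card A choose j) * h j)"
  proof (rule sum.cong)
    fix j assume "j \<in> {..k}"
    then have "{G. G \<in> {G. G \<subseteq> A \<and> card G \<le> k} \<and> card G = j} = {G. G \<subseteq> A \<and> card G = j}"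
      by auto
    then show "(\<Sum>G | G \<in> {G. G \<subseteq> A \<and> card G \<le> k} \<and> card G = j. h (card G))
        = real (card A choose j) * h j"
      using n_subsets[OF assms, of j] by simp
  qed simp
  finally show ?thesis .
qed

lemma fps_cosh_real_nth: "fps_nth fps_cosh_real k = (if even k then 1 / fact k else 0)"
proof -
  have "fps_cosh_real = fps_const (1/2) * (fps_exp 1 + fps_exp (-1))"
    unfolding fps_cosh_real_def
    by (simp add: fps_divide_unit fps_numeral_fps_const fps_const_inverse mult.commute)
  then have "fps_nth fps_cosh_real k = fps_nth (fps_const (1/2) * (fps_exp 1 + fps_exp (-1))) k"
    by (rule arg_cong)
  then show ?thesis
    by (auto simp: fps_exp_def)
qed

text \<open>Compares the coefficients of degree \<open>m\<close> in sech times cosh = 1, scaled by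
  \<open>fact m\<close>; the parity test records that cosh is even.\<close>

lemma secant_number_recurrence:
  "(\<Sum>j\<le>m. if even (m - j) then real (m choose j) * secant_number j else 0) = (if m = 0 then 1 else 0)"
proof -
  have "fps_nth fps_cosh_real 0 \<noteq> 0"
    by (simp add: fps_cosh_real_nth)
  then have "inverse fps_cosh_real * fps_cosh_real = 1"
    by (rule inverse_mult_eq_1)
  then have "fps_nth (inverse fps_cosh_real * fps_cosh_real) m = (if m = 0 then 1 else 0)"
    by simp
  then have "fact m * (\<Sum>j\<le>m. fps_nth (inverse fps_cosh_real) j * fps_nth fps_cosh_real (m - j))
      = (if m = 0 then 1 else 0)"
    by (simp add: fps_mult_nth atLeast0AtMost)
  moreover have "fact m * (fps_nth (inverse fps_cosh_real) j * fps_nth fps_cosh_real (m - j))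
      = (if even (m - j) then real (m choose j) * secant_number j else 0)" if "j \<le> m" for j
    using that by (simp add: fps_cosh_real_nth secant_number_def binomial_fact)
  ultimately show ?thesis
    by (simp add: sum_distrib_left)
qed

text \<open>Induction along the recurrence: for odd \<open>m\<close> every earlier index that passes
  the parity test is odd as well, so only the last term is left.\<close>

lemma secant_number_odd: "odd m \<Longrightarrow> secant_number m = 0"
proof (induction m rule: less_induct)
  case (less m)
  have "0 = (\<Sum>j\<le>m. if even (m - j) then real (m choose j) * secant_number j else 0)"
    using less.prems secant_number_recurrence[of m] by (cases "m = 0") (auto simp del: even_diff_nat)
  also have "\<dots> = (\<Sum>j\<in>{m}. if even (m - j) then real (m choose j) * secant_number j else 0)"
    by (rule sum.mono_neutral_right) (use less in \<open>auto simp: order_less_le\<close>)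
  finally show ?case by simp
qed

lemma secant_number_0 [simp]: "secant_number 0 = 1"
  using secant_number_recurrence[of 0] by simp

text \<open>The recurrence solved for its top term; stopping at \<open>m - 1\<close> matches a sum
  over the proper subsets of a set of size \<open>m\<close>.\<close>

lemma secant_number_rec:
  assumes "m > 0"
  shows "secant_number m = - (\<Sum>j\<le>m - 1. real (m choose j) * (if even (m - j) then secant_number j else 0))"
proof -
  have "0 = (\<Sum>j\<le>Suc (m - 1). if even (m - j) then real (m choose j) * secant_number j else 0)"
    using assms secant_number_recurrence[of m] by (simp del: even_diff_nat)
  also have "\<dots> = (\<Sum>j\<le>m - 1. if even (m - j) then real (m choose j) * secant_number j else 0)
      + secant_number m"
    using assms by (simp only: sum.atMost_Suc) simp
  finally show ?thesis
    by (simp add: if_distrib cong: if_cong)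
qed

lemma alternating_geometric_sum:
  "(\<Sum>a = 1..<g. (-1) ^ a) = (if even g \<and> g > 0 then -1 else (0::real))"
  by (induction g) (auto simp: sum.atLeastLessThan_Suc not_le)

subsection \<open>Feichtner-Yuzvinsky monomials and their signed count\<close>

lemma Union_chain_in:
  assumes "finite C" "C \<noteq> {}" "\<And>F G. F \<in> C \<Longrightarrow> G \<in> C \<Longrightarrow> F \<subseteq> G \<or> G \<subseteq> F"
  shows "\<Union>C \<in> C"
  using assms
proof (induction C rule: finite_ne_induct)
  case (insert F C)
  then have "\<Union>C \<in> C" by blast
  with insert.prems have "F \<subseteq> \<Union>C \<or> \<Union>C \<subseteq> F" by blast
  then show ?case
    using \<open>\<Union>C \<in> C\<close> by (metis Union_insert insert_iff sup.absorb1 sup.absorb2)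
qed simp

lemma Inter_chain_in:
  assumes "finite C" "C \<noteq> {}" "\<And>F G. F \<in> C \<Longrightarrow> G \<in> C \<Longrightarrow> F \<subseteq> G \<or> G \<subseteq> F"
  shows "\<Inter>C \<in> C"
  using assms
proof (induction C rule: finite_ne_induct)
  case (insert F C)
  then have "\<Inter>C \<in> C" by blast
  with insert.prems have "F \<subseteq> \<Inter>C \<or> \<Inter>C \<subseteq> F" by blast
  then show ?case
    using \<open>\<Inter>C \<in> C\<close> by (metis Inter_insert insert_iff inf.absorb1 inf.absorb2)
qed simp

text \<open>On a chain, the largest element of \<open>m\<close> strictly below \<open>F\<close>, or the empty flat if there is none.\<close>
definition pre :: "'a set multiset \<Rightarrow> 'a set \<Rightarrow> 'a set" where
  "pre m F = \<Union>{G \<in> set_mset m. G \<subset> F}"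

locale uniform_matroid =
  fixes n r :: nat
  assumes r_pos: "1 \<le> r" and r_le_n: "r \<le> n"
begin

definition E :: "nat set" where "E = {1..n}"
abbreviation L :: "nat set set" where "L \<equiv> uniform_flats n r"
abbreviation vars :: "nat set set" where "vars \<equiv> chow_vars L {}"

text \<open>The matroid rank of an arbitrary subset, since it is also applied to sets that are not
  flats.\<close>

definition rk :: "nat set \<Rightarrow> nat" where
  "rk X = min (card X) r"

text \<open>The gap of the lowest flat is measured from the empty flat; \<open>{#}\<close> belongs
  to the set and is the basis in degree 0.\<close>

definition FY :: "nat set multiset set" where
  "FY = {m. set_mset m \<subseteq> vars \<and> (\<forall>F\<in>#m. \<forall>G\<in>#m. F \<subseteq> G \<or> G \<subseteq> F) \<and>
            (\<forall>F\<in>#m. count m F + rk (pre m F) < rk F)}"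

lemma flat_iff: "F \<in> L \<longleftrightarrow> F \<subseteq> E \<and> card F < r \<or> F = E"
  using r_pos by (auto simp: uniform_flats_def E_def)

lemma finite_E: "finite E"
  by (simp add: E_def)

lemma card_E: "card E = n"
  by (simp add: E_def)

lemma E_flat: "E \<in> L"
  by (simp add: flat_iff)

lemma empty_flat: "{} \<in> L"
  using r_pos by (simp add: flat_iff)

lemma E_nonempty: "E \<noteq> {}"
  using r_pos r_le_n by (simp add: E_def)

lemma vars_iff: "F \<in> vars \<longleftrightarrow> F \<in> L \<and> F \<noteq> {}"
  by (auto simp: chow_vars_def)

lemma flat_subset: "F \<in> L \<Longrightarrow> F \<subseteq> E"
  by (auto simp: flat_iff)

lemma finite_flat: "F \<in> L \<Longrightarrow> finite F"
  by (meson finite_E finite_subset flat_subset)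

lemma finite_L: "finite L"
proof (rule finite_subset)
  show "L \<subseteq> Pow E" using flat_subset by blast
qed (simp add: finite_E)

lemma card_proper_flat: "F \<in> L \<Longrightarrow> F \<noteq> E \<Longrightarrow> card F < r"
  by (auto simp: flat_iff)

lemma subset_proper_flat: "F \<in> L \<Longrightarrow> F \<noteq> E \<Longrightarrow> G \<subseteq> F \<Longrightarrow> G \<in> L"
  by (meson card_mono finite_flat flat_iff le_less_trans order_trans)

lemma rk_E: "rk E = r"
  using r_le_n by (simp add: rk_def card_E)

lemma rk_le: "rk F \<le> r"
  by (simp add: rk_def)

lemma rk_empty [simp]: "rk {} = 0"
  by (simp add: rk_def)

lemma rk_proper: "F \<in> L \<Longrightarrow> F \<noteq> E \<Longrightarrow> rk F = card F"
  using card_proper_flat[of F] by (simp add: rk_def)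

lemma proper_subflat: "F \<in> L \<Longrightarrow> G \<in> L \<Longrightarrow> G \<subset> F \<Longrightarrow> G \<noteq> E"
  using flat_subset by blast

lemma rk_strict_mono: "F \<in> L \<Longrightarrow> G \<in> L \<Longrightarrow> G \<subset> F \<Longrightarrow> rk G < rk F"
  using card_proper_flat[OF _ proper_subflat, of G F] psubset_card_mono[OF finite_flat, of F G]
  by (simp add: rk_def)

text \<open>Files a monomial under the largest flat of its chain, and \<open>{#}\<close> under the
  empty flat.\<close>

definition FY_at :: "nat set \<Rightarrow> nat set multiset set" where
  "FY_at F = {m \<in> FY. \<Union>(set_mset m) = F}"

definition FY_at_sum :: "nat set \<Rightarrow> real" where
  "FY_at_sum F = (\<Sum>m\<in>FY_at F. (-1) ^ size m)"

lemma FY_Union: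
  assumes "m \<in> FY" "m \<noteq> {#}"
  shows "\<Union>(set_mset m) \<in># m"
  by (rule Union_chain_in) (use assms in \<open>auto simp: FY_def\<close>)

lemma FY_Union_flat: "m \<in> FY \<Longrightarrow> \<Union>(set_mset m) \<in> L"
  using FY_Union[of m] empty_flat by (cases "m = {#}") (auto simp: FY_def vars_iff)

lemma FY_at_empty: "FY_at {} = {{#}}"
proof -
  have "m = {#}" if "m \<in> FY" "\<Union>(set_mset m) = {}" for m
  proof (rule ccontr)
    assume "m \<noteq> {#}"
    then have "{} \<in># m" using FY_Union that by metis
    then show False using that(1) by (auto simp: FY_def vars_iff)
  qed
  then show ?thesis by (auto simp: FY_at_def FY_def)
qed

text \<open>Peels off the top flat \<open>F\<close> together with its exponent \<open>a\<close>. The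
  bound on an exponent depends only on the part of the chain below, so the remaining flats keep
  their bounds, and \<open>a\<close> is limited by the gap above the next flat
  \<open>G\<close>.\<close>

lemma FY_at_bij:
  assumes F: "F \<in> L" "F \<noteq> {}"
  shows "bij_betw (\<lambda>(G, m, a). m + replicate_mset a F)
           (SIGMA G:{G \<in> L. G \<subset> F}. FY_at G \<times> {1..<rk F - rk G}) (FY_at F)"
proof (rule bij_betw_byWitness[where
      f' = "\<lambda>m. (\<Union>(set_mset (filter_mset (\<lambda>G. G \<noteq> F) m)), filter_mset (\<lambda>G. G \<noteq> F) m, count m F)"])
  have notin: "F \<notin># m" if "m \<in> FY_at G" "G \<subset> F" for m G
    using that by (auto simp: FY_at_def)
  show "\<forall>x\<in>SIGMA G:{G \<in> L. G \<subset> F}. FY_at G \<times> {1..<rk F - rk G}.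
     (\<lambda>m. (\<Union>(set_mset (filter_mset (\<lambda>G. G \<noteq> F) m)), filter_mset (\<lambda>G. G \<noteq> F) m, count m F))
       ((\<lambda>(G, m, a). m + replicate_mset a F) x) = x"
  proof
    fix x assume "x \<in> (SIGMA G:{G \<in> L. G \<subset> F}. FY_at G \<times> {1..<rk F - rk G})"
    then obtain G m a where x: "x = (G, m, a)" and 1: "G \<subset> F" "m \<in> FY_at G"
      by auto
    have "filter_mset (\<lambda>G. G \<noteq> F) m = m"
      using notin[OF 1(2,1)] by (auto simp: filter_mset_eq_conv)
    moreover have "filter_mset (\<lambda>G. G \<noteq> F) (replicate_mset a F) = {#}"
      by (auto simp: filter_mset_eq_conv)
    moreover have "count m F = 0"
      using notin[OF 1(2,1)] by (simp add: not_in_iff)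
    moreover have "\<Union>(set_mset m) = G"
      using 1 by (simp add: FY_at_def)
    ultimately show "(\<lambda>m. (\<Union>(set_mset (filter_mset (\<lambda>G. G \<noteq> F) m)), filter_mset (\<lambda>G. G \<noteq> F) m, count m F))
        ((\<lambda>(G, m, a). m + replicate_mset a F) x) = x"
      by (simp add: x)
  qed
next
  show "\<forall>m\<in>FY_at F. (\<lambda>(G, m, a). m + replicate_mset a F)
     (\<Union>(set_mset (filter_mset (\<lambda>G. G \<noteq> F) m)), filter_mset (\<lambda>G. G \<noteq> F) m, count m F) = m"
    by (auto intro!: multiset_eqI)
next
  show "(\<lambda>(G, m, a). m + replicate_mset a F) `
      (SIGMA G:{G \<in> L. G \<subset> F}. FY_at G \<times> {1..<rk F - rk G}) \<subseteq> FY_at F"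
  proof (rule image_subsetI)
    fix x assume xS: "x \<in> (SIGMA G:{G \<in> L. G \<subset> F}. FY_at G \<times> {1..<rk F - rk G})"
    obtain G m a where x: "x = (G, m, a)" by (cases x)
    have G: "G \<in> L" "G \<subset> F" and m: "m \<in> FY_at G" and a: "a \<in> {1..<rk F - rk G}"
      using xS unfolding x by simp_all
    have mFY: "m \<in> FY" and UG: "\<Union>(set_mset m) = G"
      using m by (auto simp: FY_at_def)
    have below: "H \<subset> F" if "H \<in># m" for H
      using that UG G by auto
    have set: "set_mset (m + replicate_mset a F) = insert F (set_mset m)"
      using a by auto
    have preF: "pre (m + replicate_mset a F) F = G"
      using UG below by (auto simp: pre_def set)
    have cF: "count (m + replicate_mset a F) F = a"
      using below[of F] by (auto simp: count_eq_zero_iff)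
    have "{G' \<in> insert F (set_mset m). G' \<subset> H} = {G' \<in> set_mset m. G' \<subset> H}" if "H \<in># m" for H
      using below[OF that] by auto
    then have pre: "pre (m + replicate_mset a F) H = pre m H" if "H \<in># m" for H
      using that unfolding pre_def set by simp
    have cnt: "count (m + replicate_mset a F) H = count m H" if "H \<in># m" for H
      using below[OF that] by auto
    have "m + replicate_mset a F \<in> FY"
      unfolding FY_def mem_Collect_eq set
    proof (intro conjI ballI)
      show "insert F (set_mset m) \<subseteq> vars"
        using F mFY by (auto simp: FY_def vars_iff)
    next
      fix H1 H2 assume "H1 \<in> insert F (set_mset m)" "H2 \<in> insert F (set_mset m)"
      then show "H1 \<subseteq> H2 \<or> H2 \<subseteq> H1"
        using below mFY unfolding FY_def by blast
    next
      fix H assume "H \<in> insert F (set_mset m)"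
      then consider "H = F" | "H \<in># m" by auto
      then show "count (m + replicate_mset a F) H + rk (pre (m + replicate_mset a F) H) < rk H"
      proof cases
        case 1
        then show ?thesis using preF cF a by auto
      next
        case 2
        then show ?thesis using pre cnt mFY by (simp add: FY_def)
      qed
    qed
    moreover have "\<Union>(set_mset (m + replicate_mset a F)) = F"
      unfolding set using below by auto
    ultimately show "(\<lambda>(G, m, a). m + replicate_mset a F) x \<in> FY_at F"
      by (simp add: FY_at_def x)
  qed
next
  show "(\<lambda>m. (\<Union>(set_mset (filter_mset (\<lambda>G. G \<noteq> F) m)), filter_mset (\<lambda>G. G \<noteq> F) m, count m F)) ` FY_at F
      \<subseteq> (SIGMA G:{G \<in> L. G \<subset> F}. FY_at G \<times> {1..<rk F - rk G})"
  proof (rule image_subsetI)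
    fix m assume 1: "m \<in> FY_at F"
    define m' where "m' = filter_mset (\<lambda>G. G \<noteq> F) m"
    have mFY: "m \<in> FY" and UF: "\<Union>(set_mset m) = F"
      using 1 by (auto simp: FY_at_def)
    have "m \<noteq> {#}" using UF F by auto
    then have Fm: "F \<in># m" using FY_Union[OF mFY] UF by simp
    have set': "set_mset m' = {G \<in> set_mset m. G \<subset> F}"
      using UF by (auto simp: m'_def)
    have pre: "pre m' H = pre m H" if "H \<in># m'" for H
      using that unfolding pre_def set' by (rule_tac arg_cong[of _ _ Union]) auto
    have m'FY: "m' \<in> FY"
      using mFY pre unfolding FY_def by (auto simp: m'_def)
    have Um': "\<Union>(set_mset m') = pre m F"
      by (simp add: set' pre_def)
    have "\<Union>(set_mset m') \<subset> F"
    proof (cases "m' = {#}")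
      case True
      then show ?thesis using F by auto
    next
      case False
      then show ?thesis using FY_Union[OF m'FY] set' by auto
    qed
    moreover have "count m F + rk (pre m F) < rk F"
      using mFY Fm by (auto simp: FY_def)
    ultimately show "(\<Union>(set_mset (filter_mset (\<lambda>G. G \<noteq> F) m)), filter_mset (\<lambda>G. G \<noteq> F) m, count m F)
        \<in> (SIGMA G:{G \<in> L. G \<subset> F}. FY_at G \<times> {1..<rk F - rk G})"
      using FY_Union_flat[OF m'FY] m'FY Fm Um' unfolding m'_def[symmetric]
      by (simp add: FY_at_def Suc_le_eq less_diff_conv)
  qed
qed

lemma finite_FY_at: "F \<in> L \<Longrightarrow> finite (FY_at F)"
proof (induction "card F" arbitrary: F rule: less_induct)
  case less
  show ?case
  proof (cases "F = {}")
    case True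
    then show ?thesis by (simp add: FY_at_empty)
  next
    case False
    have "finite (SIGMA G:{G \<in> L. G \<subset> F}. FY_at G \<times> {1..<rk F - rk G})"
    proof (rule finite_SigmaI)
      show "finite (FY_at G \<times> {1..<rk F - rk G})" if "G \<in> {G \<in> L. G \<subset> F}" for G
        using that less.hyps[of G] psubset_card_mono[OF finite_flat[OF less.prems]] by simp
    qed (use finite_L in simp)
    then show ?thesis
      using bij_betw_finite[OF FY_at_bij[OF less.prems False]] by simp
  qed
qed

text \<open>Along \<open>FY_at_bij\<close> the sum over the exponent of \<open>F\<close> separates;
  as the gap is positive, it is -1 for an even gap and 0 for an odd one.\<close>

lemma FY_at_sum_rec:
  assumes "F \<in> L" "F \<noteq> {}"
  shows "FY_at_sum F = (\<Sum>G | G \<in> L \<and> G \<subset> F. - (if even (rk F - rk G) then FY_at_sum G else 0))"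
proof -
  have "FY_at_sum F = (\<Sum>(G, m, a)\<in>(SIGMA G:{G \<in> L. G \<subset> F}. FY_at G \<times> {1..<rk F - rk G}). (-1) ^ size m * (-1) ^ a)"
    unfolding FY_at_sum_def
    by (subst sum.reindex_bij_betw[OF FY_at_bij[OF assms], symmetric])
       (auto intro!: sum.cong simp: power_add)
  also have "\<dots> = (\<Sum>G | G \<in> L \<and> G \<subset> F. \<Sum>(m, a)\<in>FY_at G \<times> {1..<rk F - rk G}. (-1) ^ size m * (-1) ^ a)"
    using finite_L by (subst sum.Sigma) (auto intro: finite_FY_at)
  also have "\<dots> = (\<Sum>G | G \<in> L \<and> G \<subset> F. FY_at_sum G * (\<Sum>a = 1..<rk F - rk G. (-1) ^ a))"
    by (simp add: FY_at_sum_def sum_product sum.cartesian_product)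
  also have "\<dots> = (\<Sum>G | G \<in> L \<and> G \<subset> F. - (if even (rk F - rk G) then FY_at_sum G else 0))"
    unfolding alternating_geometric_sum
    by (intro sum.cong) (use rk_strict_mono[OF assms(1)] in auto)
  finally show ?thesis .
qed

text \<open>Below a proper flat the lattice is Boolean with rank equal to cardinality, so the
  recursion for \<open>FY_at_sum\<close> is the one for the secant numbers.\<close>

lemma FY_at_sum_proper: "F \<in> L \<Longrightarrow> F \<noteq> E \<Longrightarrow> FY_at_sum F = secant_number (card F)"
proof (induction "card F" arbitrary: F rule: less_induct)
  case less
  show ?case
  proof (cases "F = {}")
    case True
    then show ?thesis by (simp add: FY_at_sum_def FY_at_empty)
  next
    case False
    have fin: "finite F" and pos: "card F > 0"
      using False finite_flat[OF less.prems(1)] by auto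
    have eq: "{G. G \<in> L \<and> G \<subset> F} = {G. G \<subseteq> F \<and> card G \<le> card F - 1}"
    proof (rule Collect_cong)
      fix G
      have "G \<subset> F \<longleftrightarrow> G \<subseteq> F \<and> card G \<noteq> card F"
        using card_subset_eq[OF fin] by blast
      then have "G \<subset> F \<longleftrightarrow> G \<subseteq> F \<and> card G \<le> card F - 1"
        using card_mono[OF fin, of G] pos by auto
      then show "G \<in> L \<and> G \<subset> F \<longleftrightarrow> G \<subseteq> F \<and> card G \<le> card F - 1"
        using subset_proper_flat[OF less.prems] by blast
    qed
    have "FY_at_sum F = (\<Sum>G | G \<in> L \<and> G \<subset> F. - (if even (card F - card G) then secant_number (card G) else 0))"
      unfolding FY_at_sum_rec[OF less.prems(1) False]
    proof (rule sum.cong)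
      fix G assume "G \<in> {G. G \<in> L \<and> G \<subset> F}"
      then have G: "G \<in> L" "G \<subset> F" by auto
      then have "G \<noteq> E" using proper_subflat less.prems(1) by blast
      then show "- (if even (rk F - rk G) then FY_at_sum G else 0)
          = - (if even (card F - card G) then secant_number (card G) else 0)"
        using less.hyps[OF psubset_card_mono[OF fin G(2)] G(1)] G less.prems by (simp add: rk_proper)
    qed simp
    also have "\<dots> = (\<Sum>j\<le>card F - 1. real (card F choose j) * - (if even (card F - j) then secant_number j else 0))"
      unfolding eq by (rule sum_subsets_by_card[OF fin])
    also have "\<dots> = secant_number (card F)"
      unfolding secant_number_rec[OF pos] by (simp add: sum_negf)
    finally show ?thesis .
  qed
qed

text \<open>With \<open>r\<close> odd, an even gap below \<open>E\<close> forces
  \<open>card G\<close> to be odd, and then the secant number at \<open>card G\<close>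
  vanishes.\<close>

lemma FY_at_sum_E:
  assumes "odd r"
  shows "FY_at_sum E = 0"
  unfolding FY_at_sum_rec[OF E_flat E_nonempty]
proof (intro sum.neutral ballI)
  fix G assume "G \<in> {G. G \<in> L \<and> G \<subset> E}"
  then have G: "G \<in> L" "G \<subset> E" by auto
  then have "card G < r" using card_proper_flat by blast
  moreover have "FY_at_sum G = secant_number (card G)" using FY_at_sum_proper G by blast
  ultimately show "- (if even (rk E - rk G) then FY_at_sum G else 0) = 0"
    using assms G secant_number_odd[of "card G"] rk_proper[of G] by (auto simp: rk_E)
qed

lemma FY_eq_UN_FY_at: "FY = (\<Union>F\<in>L. FY_at F)"
  using FY_Union_flat by (auto simp: FY_at_def)

lemma finite_FY: "finite FY"
  unfolding FY_eq_UN_FY_at using finite_L finite_FY_at by auto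

lemma FY_signed_count:
  assumes "odd r"
  shows "(\<Sum>m\<in>FY. (-1) ^ size m) = (\<Sum>k = 0..(r - 1) div 2. real (n choose (2 * k)) * secant_number (2 * k))"
proof -
  have proper: "L - {E} = {G. G \<subseteq> E \<and> card G \<le> r - 1}"
    using r_pos r_le_n by (auto simp: flat_iff card_E)
  obtain q where q: "r = 2 * q + 1" using assms by (elim oddE)
  have "(\<Sum>m\<in>FY. (-1) ^ size m) = (\<Sum>F\<in>L. FY_at_sum F)"
    unfolding FY_eq_UN_FY_at FY_at_sum_def
    by (rule sum.UNION_disjoint) (use finite_L finite_FY_at in \<open>auto simp: FY_at_def\<close>)
  also have "\<dots> = (\<Sum>F\<in>L - {E}. secant_number (card F))"
    using FY_at_sum_E[OF assms] FY_at_sum_proper by (simp add: sum.remove[OF finite_L E_flat])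
  also have "\<dots> = (\<Sum>j\<le>r - 1. real (n choose j) * secant_number j)"
    unfolding proper by (subst sum_subsets_by_card) (auto simp: finite_E card_E)
  \<comment> \<open>The odd indices drop out; as \<open>r - 1 = 2 * q\<close>, the even ones are the
    doubles of the numbers up to \<open>q\<close>.\<close>
  also have "\<dots> = (\<Sum>j\<in>(\<lambda>k. 2 * k) ` {0..(r - 1) div 2}. real (n choose j) * secant_number j)"
  proof (rule sum.mono_neutral_right)
    show "\<forall>j\<in>{..r - 1} - (\<lambda>k. 2 * k) ` {0..(r - 1) div 2}. real (n choose j) * secant_number j = 0"
    proof
      fix j assume j: "j \<in> {..r - 1} - (\<lambda>k. 2 * k) ` {0..(r - 1) div 2}"
      have "odd j"
      proof
        assume "even j"
        then obtain k where "j = 2 * k" by (elim evenE)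
        with j q show False by auto
      qed
      then show "real (n choose j) * secant_number j = 0" by (simp add: secant_number_odd)
    qed
  qed (use q in auto)
  also have "\<dots> = (\<Sum>k = 0..(r - 1) div 2. real (n choose (2 * k)) * secant_number (2 * k))"
    by (subst sum.reindex) (auto simp: inj_on_def)
  finally show ?thesis .
qed

end

subsection \<open>Rank of a graded piece\<close>

text \<open>Gaussian elimination without division: one coordinate and one vector are removed at a
  time.\<close>

lemma int_vectors_dependent:
  fixes g :: "'s \<Rightarrow> 'b \<Rightarrow> int"
  assumes "finite B" "finite S" "card B < card S"
  shows "\<exists>c. (\<exists>s\<in>S. c s \<noteq> 0) \<and> (\<forall>b\<in>B. (\<Sum>s\<in>S. c s * g s b) = 0)"
  using assms
proof (induction B arbitrary: S g rule: finite_induct)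
  case empty
  then obtain s where "s \<in> S" by fastforce
  then show ?case by (intro exI[of _ "\<lambda>_. 1"]) auto
next
  case (insert b B)
  show ?case
  proof (cases "\<forall>s\<in>S. g s b = 0")
    case True
    then show ?thesis using insert.IH[of S g] insert.prems insert.hyps by auto
  next
    case False
    then obtain t where t: "t \<in> S" "g t b \<noteq> 0" by blast
    \<comment> \<open>Cross-multiplication with the pivot \<open>t\<close> clears coordinate
      \<open>b\<close> within the integers.\<close>
    define g' where "g' s x = g t b * g s x - g s b * g t x" for s x
    have "card B < card (S - {t})"
      using insert t by simp
    then obtain c where c: "\<exists>s\<in>S - {t}. c s \<noteq> 0" "\<forall>x\<in>B. (\<Sum>s\<in>S - {t}. c s * g' s x) = 0"
      using insert.IH[of "S - {t}" g'] insert.prems by auto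
    \<comment> \<open>The coefficient of \<open>t\<close> collects what was subtracted in forming
      \<open>g'\<close>, so that both combinations agree in every coordinate.\<close>
    define c' where "c' s = (if s = t then - (\<Sum>s\<in>S - {t}. c s * g s b) else g t b * c s)" for s
    have sum_c': "(\<Sum>s\<in>S. c' s * g s x) = (\<Sum>s\<in>S - {t}. c s * g' s x)" for x
    proof -
      have "(\<Sum>s\<in>S. c' s * g s x) = c' t * g t x + (\<Sum>s\<in>S - {t}. c' s * g s x)"
        using insert.prems t by (simp add: sum.remove)
      also have "(\<Sum>s\<in>S - {t}. c' s * g s x) = (\<Sum>s\<in>S - {t}. g t b * c s * g s x)"
        by (rule sum.cong) (auto simp: c'_def)
      finally show ?thesis
        by (simp add: c'_def g'_def sum_distrib_right sum_distrib_left sum_subtractf algebra_simps)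
    qed
    have "(\<Sum>s\<in>S. c' s * g s x) = 0" if "x \<in> insert b B" for x
      using that c(2) by (auto simp: sum_c') (simp add: g'_def)
    moreover have "\<exists>s\<in>S. c' s \<noteq> 0"
      using c(1) t by (auto simp: c'_def)
    ultimately show ?thesis by blast
  qed
qed

lemma zspan_sum:
  assumes "finite A" "\<And>a. a \<in> A \<Longrightarrow> f a \<in> zspan G"
  shows "(\<lambda>x. \<Sum>a\<in>A. f a x) \<in> zspan G"
  using assms by (induction A rule: finite_induct) (auto intro: zspan.zero zspan.add)

lemma zspan_diff:
  assumes "f \<in> zspan G" "g \<in> zspan G"
  shows "(\<lambda>x. f x - g x) \<in> zspan G"
  using zspan.add[OF assms(1) zspan.neg[OF assms(2)]] by simp

lemma zspan_scale:
  assumes f: "f \<in> zspan G"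
  shows "(\<lambda>x. c * f x) \<in> zspan G"
proof -
  have *: "(\<lambda>x. int k * f x) \<in> zspan G" for k
  proof (induction k)
    case (Suc k)
    have "(\<lambda>x. int (Suc k) * f x) = (\<lambda>x. f x + int k * f x)" by (simp add: algebra_simps)
    then show ?case using zspan.add[OF f Suc] by simp
  qed (simp add: zspan.zero)
  show ?thesis
  proof (cases "c \<ge> 0")
    case True
    with *[of "nat c"] show ?thesis by simp
  next
    case False
    with zspan.neg[OF *[of "nat (- c)"]] show ?thesis by simp
  qed
qed

lemma finite_support_sum_monomials:
  assumes "finite A" "\<And>x. f x \<noteq> 0 \<Longrightarrow> x \<in> A"
  shows "f = (\<lambda>x. \<Sum>m\<in>A. f m * monomial_poly m x)"
proof
  fix x
  have "(\<Sum>m\<in>A. f m * monomial_poly m x) = (\<Sum>m\<in>A. if m = x then f x else 0)"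
    by (rule sum.cong) (auto simp: monomial_poly_def)
  also have "\<dots> = (if x \<in> A then f x else 0)"
    using assms(1) by simp
  also have "\<dots> = f x"
    using assms(2)[of x] by argo
  finally show "f x = (\<Sum>m\<in>A. f m * monomial_poly m x)" by (rule sym)
qed

lemma combination_support:
  fixes c :: "'a \<Rightarrow> 'b::semiring_0"
  shows "(\<Sum>m\<in>A. c m * e m x) \<noteq> 0 \<Longrightarrow> \<exists>m\<in>A. e m x \<noteq> 0"
  by (rule ccontr) simp

lemma inj_monomial_poly: "inj monomial_poly"
proof (rule injI)
  fix m k :: "'a set multiset"
  assume "monomial_poly m = monomial_poly k"
  then have "monomial_poly m m = monomial_poly k m" by simp
  then show "m = k" by (simp add: monomial_poly_def split: if_splits)
qed

text \<open>Reduces the rank to the two properties of a monomial basis \<open>B\<close>: the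
  monomials of degree \<open>d\<close> reduce to combinations of \<open>B\<close>, and no nonzero
  combination of \<open>B\<close> lies in the ideal.\<close>

lemma chow_rank_eqI:
  fixes L :: "'a set set" and B :: "'a set multiset set"
  assumes fin: "finite B"
    and B: "\<And>m. m \<in> B \<Longrightarrow> size m = d \<and> set_mset m \<subseteq> chow_vars L bt"
    and span: "\<And>m. size m = d \<Longrightarrow> set_mset m \<subseteq> chow_vars L bt \<Longrightarrow>
      \<exists>e. (\<lambda>x. monomial_poly m x - e x) \<in> chow_ideal L bt \<and> (\<forall>x. e x \<noteq> 0 \<longrightarrow> x \<in> B)"
    and indep: "\<And>f. f \<in> chow_ideal L bt \<Longrightarrow> (\<And>m. f m \<noteq> 0 \<Longrightarrow> m \<in> B) \<Longrightarrow> f = (\<lambda>_. 0)"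
  shows "chow_rank L bt d = card B"
proof -
  \<comment> \<open>If \<open>S\<close> were larger than \<open>B\<close>, the reductions of its
    members to \<open>B\<close> would satisfy an integer relation, which would hold for
    \<open>S\<close> modulo the ideal.\<close>
  have upper: "card S \<le> card B" if S: "indep_mod_ideal L bt d S" for S
  proof (rule ccontr)
    assume "\<not> card S \<le> card B"
    moreover have finS: "finite S"
      using S by (simp add: indep_mod_ideal_def)
    have "\<exists>e. (\<lambda>x. s x - e x) \<in> chow_ideal L bt \<and> (\<forall>x. e x \<noteq> 0 \<longrightarrow> x \<in> B)" if "s \<in> S" for s
    proof -
      define A where "A = {m. s m \<noteq> 0}"
      have s: "is_poly L bt s" "homog d s"
        using S that by (auto simp: indep_mod_ideal_def)
      then have finA: "finite A" by (simp add: is_poly_def A_def)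
      have "\<exists>e. (\<lambda>x. monomial_poly m x - e x) \<in> chow_ideal L bt \<and> (\<forall>x. e x \<noteq> 0 \<longrightarrow> x \<in> B)"
        if "m \<in> A" for m
        using span[of m] s that by (auto simp: is_poly_def homog_def A_def)
      then obtain e where e: "\<And>m. m \<in> A \<Longrightarrow> (\<lambda>x. monomial_poly m x - e m x) \<in> chow_ideal L bt"
        "\<And>m x. m \<in> A \<Longrightarrow> e m x \<noteq> 0 \<Longrightarrow> x \<in> B" by metis
      have "(\<lambda>x. \<Sum>m\<in>A. s m * (monomial_poly m x - e m x)) \<in> chow_ideal L bt"
        using e(1) unfolding chow_ideal_def by (intro zspan_sum[OF finA] zspan_scale)
      moreover have "(\<Sum>m\<in>A. s m * monomial_poly m x) = s x" for x
        by (rule fun_cong[OF finite_support_sum_monomials[OF finA, of s], symmetric]) (simp add: A_def)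
      ultimately have "(\<lambda>x. s x - (\<Sum>m\<in>A. s m * e m x)) \<in> chow_ideal L bt"
        by (simp add: sum_subtractf right_diff_distrib)
      then show ?thesis
        using e(2) combination_support[of s e _ A] by (intro exI[of _ "\<lambda>x. \<Sum>m\<in>A. s m * e m x"]) blast
    qed
    then obtain e where e: "\<And>s. s \<in> S \<Longrightarrow> (\<lambda>x. s x - e s x) \<in> chow_ideal L bt"
      "\<And>s x. s \<in> S \<Longrightarrow> e s x \<noteq> 0 \<Longrightarrow> x \<in> B" by metis
    obtain c where c: "\<exists>s\<in>S. c s \<noteq> 0" "\<forall>b\<in>B. (\<Sum>s\<in>S. c s * e s b) = 0"
      using int_vectors_dependent[OF fin finS, of e] \<open>\<not> card S \<le> card B\<close> by auto
    have "(\<Sum>s\<in>S. c s * e s x) = 0" for x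
    proof (cases "x \<in> B")
      case False
      then show ?thesis using e(2) by (intro sum.neutral) auto
    qed (use c in auto)
    moreover have "(\<lambda>x. \<Sum>s\<in>S. c s * (s x - e s x)) \<in> chow_ideal L bt"
      using e(1) unfolding chow_ideal_def by (intro zspan_sum[OF finS] zspan_scale)
    ultimately have "(\<lambda>x. \<Sum>s\<in>S. c s * s x) \<in> chow_ideal L bt"
      by (simp add: right_diff_distrib sum_subtractf)
    then have "\<forall>s\<in>S. c s = 0"
      using S unfolding indep_mod_ideal_def by blast
    with c(1) show False by blast
  qed
  have inj: "inj_on monomial_poly B"
    using inj_monomial_poly by (rule inj_on_subset) simp
  have "indep_mod_ideal L bt d (monomial_poly ` B)"
    unfolding indep_mod_ideal_def
  proof (intro conjI ballI allI impI)
    fix s assume "s \<in> monomial_poly ` B"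
    then obtain m where m: "m \<in> B" "s = monomial_poly m" by blast
    have "{x. monomial_poly m x \<noteq> 0} = {m}" by (auto simp: monomial_poly_def)
    then show "is_poly L bt s" "homog d s"
      using B[OF m(1)] m(2) by (auto simp: is_poly_def homog_def)
  next
    fix c s assume c: "(\<lambda>m. \<Sum>s\<in>monomial_poly ` B. c s * s m) \<in> chow_ideal L bt"
      and s: "s \<in> monomial_poly ` B"
    have eq: "(\<Sum>s\<in>monomial_poly ` B. c s * s m) = (if m \<in> B then c (monomial_poly m) else 0)" for m
    proof -
      have "(\<Sum>s\<in>monomial_poly ` B. c s * s m)
          = (\<Sum>x\<in>B. if x = m then c (monomial_poly m) else 0)"
        by (subst sum.reindex[OF inj]) (auto intro!: sum.cong simp: monomial_poly_def)
      then show ?thesis using fin by simp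
    qed
    have "(\<lambda>m. \<Sum>s\<in>monomial_poly ` B. c s * s m) = (\<lambda>_. 0)"
      by (rule indep[OF c]) (auto simp: eq split: if_splits)
    then show "c s = 0"
      using s by (auto simp: eq fun_eq_iff split: if_splits)
  qed (use fin in auto)
  then have "card B \<in> {card S |S. indep_mod_ideal L bt d S}"
    using card_image[OF inj] by (auto intro!: exI[of _ "monomial_poly ` B"])
  moreover have "finite {card S |S. indep_mod_ideal L bt d S}"
    using upper by (auto intro: finite_subset[of _ "{..card B}"])
  ultimately show ?thesis
    unfolding chow_rank_def using upper by (intro Max_eqI) auto
qed

subsection \<open>Spanning\<close>

abbreviation "lookup \<equiv> Poly_Mapping.lookup"
abbreviation "keys \<equiv> Poly_Mapping.keys"

text \<open>Polynomials become elements of the monoid ring of multisets under addition, which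
  supplies products and powers; \<open>frag_of m\<close> is the monomial \<open>m\<close>.\<close>

abbreviation X :: "'a \<Rightarrow> 'a multiset \<Rightarrow>\<^sub>0 int" where
  "X F \<equiv> frag_of {#F#}"

lemma lookup_single_one: "lookup (frag_of m) = monomial_poly m"
  by (auto simp: monomial_poly_def)

declare lookup_frag_of [simp del]

lemma lookup_single_times:
  fixes p :: "'a set multiset \<Rightarrow>\<^sub>0 int"
  shows "lookup (frag_of m * p) = mono_mult m (lookup p)"
proof
  fix k
  have "lookup (frag_of m * p) k = (\<Sum>q. lookup p q when k = m + q)"
    by (simp add: lookup_mult lookup_single when_mult del: lookup_frag_of)
  also have "\<dots> = mono_mult m (lookup p) k"
  proof (cases "m \<subseteq># k")
    case True
    then have "k = m + q \<longleftrightarrow> k - m = q" for q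
      by auto
    then show ?thesis using True by (simp add: mono_mult_def)
  next
    case False
    then have "k \<noteq> m + q" for q
      by auto
    then show ?thesis using False by (simp add: mono_mult_def)
  qed
  finally show "lookup (frag_of m * p) k = mono_mult m (lookup p) k" .
qed

lemma mono_mult_monomial: "mono_mult m (monomial_poly k) = monomial_poly (m + k)"
  unfolding lookup_single_one[symmetric] lookup_single_times[symmetric] by (simp add: mult_single)

lemma mono_mult_mono_mult: "mono_mult m (mono_mult k g) = mono_mult (m + k) g"
  by (auto simp: mono_mult_def fun_eq_iff subset_mset.le_diff_conv2 add.commute
      dest: subset_mset.order_trans[OF mset_subset_eq_add_left] subset_mset.order_trans[OF mset_subset_eq_add_right])

text \<open>The ideal is given as an integer span of monomial multiples of the generators, and these
  multiples are permuted among themselves by a further monomial factor.\<close>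

lemma chow_ideal_mono_mult:
  assumes f: "f \<in> chow_ideal L bt" and m: "set_mset m \<subseteq> chow_vars L bt"
  shows "mono_mult m f \<in> chow_ideal L bt"
  using f unfolding chow_ideal_def
proof (induction rule: zspan.induct)
  case zero
  have "mono_mult m (\<lambda>_. 0) = (\<lambda>_. 0)" by (simp add: mono_mult_def)
  then show ?case by (simp add: zspan.zero)
next
  case (gen g)
  then obtain k h where "g = mono_mult k h" "set_mset k \<subseteq> chow_vars L bt" "h \<in> chow_gens L bt"
    by blast
  then show ?case
    using m by (auto simp: mono_mult_mono_mult intro!: zspan.gen exI[of _ "m + k"] exI[of _ h])
next
  case (add f g)
  have "mono_mult m (\<lambda>x. f x + g x) = (\<lambda>x. mono_mult m f x + mono_mult m g x)"
    by (auto simp: mono_mult_def)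
  then show ?case using add by (simp add: zspan.add)
next
  case (neg f)
  have "mono_mult m (\<lambda>x. - f x) = (\<lambda>x. - mono_mult m f x)"
    by (auto simp: mono_mult_def)
  then show ?case using neg by (simp add: zspan.neg)
qed

text \<open>Serves as the term order: within a degree it is bounded by \<open>weight_le\<close>, so
  rewriting towards larger weight terminates.\<close>

definition weight :: "'a set multiset \<Rightarrow> nat" where
  "weight m = sum_mset (image_mset card m)"

lemma weight_simps [simp]:
  "weight {#} = 0" "weight (add_mset F m) = card F + weight m" "weight (m + k) = weight m + weight k"
  by (simp_all add: weight_def)

text \<open>Monomials on larger flats are the lower order terms.\<close>
definition lead :: "'a set set \<Rightarrow> ('a set multiset \<Rightarrow>\<^sub>0 int) \<Rightarrow> 'a set multiset \<Rightarrow> int \<Rightarrow> bool" where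
  "lead V p m c \<longleftrightarrow> set_mset m \<subseteq> V \<and> (\<exists>s. p = Poly_Mapping.single m c + s \<and>
     (\<forall>k\<in>keys s. size k = size m \<and> set_mset k \<subseteq> V \<and> weight m < weight k))"

lemma leadI:
  assumes "set_mset m \<subseteq> V" "p = Poly_Mapping.single m c + s"
    "\<And>k. k \<in> keys s \<Longrightarrow> size k = size m \<and> set_mset k \<subseteq> V \<and> weight m < weight k"
  shows "lead V p m c"
  using assms by (auto simp: lead_def)

lemma leadE:
  assumes "lead V p m c"
  obtains s where "set_mset m \<subseteq> V" "p = Poly_Mapping.single m c + s"
    "\<And>k. k \<in> keys s \<Longrightarrow> size k = size m \<and> set_mset k \<subseteq> V \<and> weight m < weight k"
  using assms by (auto simp: lead_def)

lemma lead_single: "set_mset m \<subseteq> V \<Longrightarrow> lead V (Poly_Mapping.single m c) m c"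
  by (rule leadI[where s = 0]) auto

lemma lead_one: "lead V 1 {#} 1"
  using lead_single[of "{#}" V 1] by (simp flip: zero_multiset_def)

text \<open>Degree and weight are additive, so a product with a factor of lower order is of lower
  order.\<close>

lemma lead_mult:
  assumes "lead V p m c" "lead V q k d"
  shows "lead V (p * q) (m + k) (c * d)"
proof -
  obtain s where s: "set_mset m \<subseteq> V" "p = Poly_Mapping.single m c + s"
    "\<And>x. x \<in> keys s \<Longrightarrow> size x = size m \<and> set_mset x \<subseteq> V \<and> weight m < weight x"
    using assms(1) by (rule leadE) blast
  obtain t where t: "set_mset k \<subseteq> V" "q = Poly_Mapping.single k d + t"
    "\<And>x. x \<in> keys t \<Longrightarrow> size x = size k \<and> set_mset x \<subseteq> V \<and> weight k < weight x"
    using assms(2) by (rule leadE) blast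
  show ?thesis
  proof (rule leadI)
    show "set_mset (m + k) \<subseteq> V" using s(1) t(1) by simp
    show "p * q = Poly_Mapping.single (m + k) (c * d) + (Poly_Mapping.single m c * t + s * q)"
      by (simp add: s(2) t(2) distrib_left distrib_right mult_single add.assoc)
    fix x assume "x \<in> keys (Poly_Mapping.single m c * t + s * q)"
    then consider "x \<in> keys (Poly_Mapping.single m c * t)" | "x \<in> keys (s * q)"
      using keys_add[of "Poly_Mapping.single m c * t" "s * q"] by blast
    then show "size x = size (m + k) \<and> set_mset x \<subseteq> V \<and> weight (m + k) < weight x"
    proof cases
      case 1
      then obtain a b where "x = a + b" "a \<in> keys (Poly_Mapping.single m c)" "b \<in> keys t"
        using keys_mult[of "Poly_Mapping.single m c" t] by blast
      then show ?thesis
        using s(1) t(3)[of b] by (auto split: if_splits)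
    next
      case 2
      then obtain a b where ab: "x = a + b" "a \<in> keys s" "b \<in> keys q"
        using keys_mult[of s q] by blast
      then have "b = k \<or> b \<in> keys t"
        using keys_add[of "Poly_Mapping.single k d" t] by (auto simp: t(2) split: if_splits)
      then have "size b = size k \<and> set_mset b \<subseteq> V \<and> weight k \<le> weight b"
        using t(1) t(3)[of b] by auto
      then show ?thesis
        using ab s(3)[of a] by auto
    qed
  qed
qed

lemma lead_power: "lead V p {#F#} 1 \<Longrightarrow> lead V (p ^ g) (replicate_mset g F) 1"
proof (induction g)
  case (Suc g)
  then show ?case using lead_mult[of V p "{#F#}" 1 "p ^ g" "replicate_mset g F" 1] by simp
qed (simp add: lead_one)

lemma keys_sum_X: "finite A \<Longrightarrow> k \<in> keys (\<Sum>G\<in>A. X G) \<Longrightarrow> \<exists>G\<in>A. k = {#G#}"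
proof (induction A rule: finite_induct)
  case (insert G A)
  then show ?case using keys_add[of "X G" "\<Sum>G\<in>A. X G"] by auto
qed simp

section \<open>Relations in the Chow ring and reduction to the basis\<close>

context uniform_matroid
begin

text \<open>Carries the ideal over to the monoid ring. The ring has variables for all sets, so
  closure under products is claimed only for factors built from \<open>vars\<close>.\<close>

definition Ideal :: "(nat set multiset \<Rightarrow>\<^sub>0 int) set" where
  "Ideal = {p. lookup p \<in> chow_ideal L {}}"

lemma Ideal_zero: "0 \<in> Ideal"
  by (simp add: Ideal_def chow_ideal_def zero_poly_mapping.rep_eq zspan.zero)

lemma Ideal_add: "p \<in> Ideal \<Longrightarrow> q \<in> Ideal \<Longrightarrow> p + q \<in> Ideal"
  by (simp add: Ideal_def chow_ideal_def plus_poly_mapping.rep_eq zspan.add)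

lemma Ideal_diff: "p \<in> Ideal \<Longrightarrow> q \<in> Ideal \<Longrightarrow> p - q \<in> Ideal"
  by (simp add: Ideal_def chow_ideal_def minus_poly_mapping.rep_eq zspan_diff)

lemma Ideal_sum: "(\<And>a. a \<in> A \<Longrightarrow> f a \<in> Ideal) \<Longrightarrow> sum f A \<in> Ideal"
  by (induction A rule: infinite_finite_induct) (auto intro: Ideal_zero Ideal_add)

lemma Ideal_monomial: "set_mset m \<subseteq> vars \<Longrightarrow> p \<in> Ideal \<Longrightarrow> frag_of m * p \<in> Ideal"
  by (simp add: Ideal_def lookup_single_times chow_ideal_mono_mult)

lemma Ideal_X: "F \<in> vars \<Longrightarrow> p \<in> Ideal \<Longrightarrow> X F * p \<in> Ideal"
  by (rule Ideal_monomial) auto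

lemma Ideal_gen:
  assumes "lookup p \<in> chow_gens L {}"
  shows "p \<in> Ideal"
proof -
  have "mono_mult {#} (lookup p) = lookup p" by (auto simp: mono_mult_def)
  then show ?thesis
    using assms unfolding Ideal_def chow_ideal_def
    by (auto intro!: zspan.gen exI[of _ "{#}"] exI[of _ "lookup p"])
qed

lemma Ideal_incomparable:
  assumes "F \<in> vars" "G \<in> vars" "\<not> F \<subseteq> G" "\<not> G \<subseteq> F"
  shows "X F * X G \<in> Ideal"
proof (rule Ideal_gen)
  have "lookup (X F * X G) = monomial_poly {#F, G#}"
    by (simp add: mult_single lookup_single_one add_mset_commute)
  then show "lookup (X F * X G) \<in> chow_gens L {}"
    using assms by (auto simp: chow_gens_def)
qed

text \<open>The matroid closure of a subset of \<open>E\<close>; on a union of two flats it is their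
  join.\<close>

definition cl :: "nat set \<Rightarrow> nat set" where
  "cl S = (if card S < r then S else E)"

lemma cl_flat: "S \<subseteq> E \<Longrightarrow> cl S \<in> L"
  by (auto simp: cl_def flat_iff)

lemma subset_cl: "S \<subseteq> E \<Longrightarrow> S \<subseteq> cl S"
  by (auto simp: cl_def)

lemma cl_least: "F \<in> L \<Longrightarrow> S \<subseteq> F \<Longrightarrow> cl S \<subseteq> F"
  using card_mono[OF finite_flat, of F S] by (auto simp: cl_def flat_iff)

lemma cl_subset_iff: "F \<in> L \<Longrightarrow> S \<subseteq> E \<Longrightarrow> cl S \<subseteq> F \<longleftrightarrow> S \<subseteq> F"
  using cl_least subset_cl by blast

lemma rk_cl: "rk (cl S) = rk S"
  using r_le_n by (simp add: cl_def rk_def card_E)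

text \<open>For \<open>r = 1\<close> the only atom is \<open>E\<close>; otherwise the atoms are the
  singletons.\<close>

lemma cl_singleton_atom:
  assumes "a \<in> E"
  shows "cl {a} \<in> lattice_atoms L {}"
proof -
  have sub: "{a} \<subseteq> E" using assms by simp
  have "\<not> (\<exists>G\<in>L. {} \<subset> G \<and> G \<subset> cl {a})"
  proof (cases "r = 1")
    case True
    have "G = {}" if "G \<in> L" "G \<subset> cl {a}" for G
      using card_proper_flat[OF that(1) proper_subflat[OF cl_flat[OF sub] that]] finite_flat[OF that(1)] True
      by simp
    then show ?thesis by blast
  next
    case False
    then have "cl {a} = {a}" using r_pos by (simp add: cl_def)
    then show ?thesis by auto
  qed
  then show ?thesis
    using cl_flat[OF sub] subset_cl[OF sub] by (auto simp: lattice_atoms_def)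
qed

definition above :: "nat set \<Rightarrow> nat set set" where
  "above F = {G \<in> L. F \<subseteq> G}"

lemma finite_above: "finite (above F)"
  using finite_L by (simp add: above_def)

lemma above_vars: "F \<noteq> {} \<Longrightarrow> above F \<subseteq> vars"
  by (auto simp: above_def vars_iff)

lemma lookup_sum_X: "finite A \<Longrightarrow> lookup (\<Sum>G\<in>A. X G) = (\<lambda>m. if \<exists>G. m = {#G#} \<and> G \<in> A then 1 else 0)"
  by (induction A rule: finite_induct)
     (auto simp: zero_poly_mapping.rep_eq lookup_add lookup_single when_def fun_eq_iff)

text \<open>A flat contains the element \<open>a\<close> exactly if it contains the atom
  \<open>cl {a}\<close>, so the linear relations may be indexed by elements.\<close>

lemma Ideal_atom:
  assumes "a \<in> E"
  shows "(\<Sum>G\<in>above {a}. X G) \<in> Ideal"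
proof (rule Ideal_gen)
  have "G \<in> above {a} \<longleftrightarrow> G \<in> vars \<and> cl {a} \<subseteq> G" for G
    using assms cl_subset_iff[of G "{a}"] by (auto simp: above_def vars_iff)
  then show "lookup (\<Sum>G\<in>above {a}. X G) \<in> chow_gens L {}"
    unfolding chow_gens_def lookup_sum_X[OF finite_above] using cl_singleton_atom[OF assms] by auto
qed

definition Y :: "nat set \<Rightarrow> nat set multiset \<Rightarrow>\<^sub>0 int" where
  "Y F = (\<Sum>G\<in>above F. X G)"

text \<open>The convention \<open>x\<^sub>F = 1\<close> for the empty flat covers the relations without a lower flat.\<close>
definition X' :: "nat set \<Rightarrow> nat set multiset \<Rightarrow>\<^sub>0 int" where
  "X' F = (if F = {} then 1 else X F)"

lemma Ideal_X': "F \<in> L \<Longrightarrow> p \<in> Ideal \<Longrightarrow> X' F * p \<in> Ideal"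
  using Ideal_X[of F p] by (auto simp: X'_def vars_iff)

lemma Ideal_Y: "F \<noteq> {} \<Longrightarrow> p \<in> Ideal \<Longrightarrow> Y F * p \<in> Ideal"
  using above_vars by (auto simp: Y_def sum_distrib_right intro!: Ideal_sum Ideal_X)

lemma Ideal_Y_power: "F \<noteq> {} \<Longrightarrow> p \<in> Ideal \<Longrightarrow> Y F ^ k * p \<in> Ideal"
  by (induction k) (auto simp: mult.assoc intro: Ideal_Y)

lemma Y_split: "F \<subseteq> V \<Longrightarrow> Y F = Y V + (\<Sum>G\<in>above F - above V. X G)"
  unfolding Y_def using sum.subset_diff[of "above V" "above F" X] finite_above
  by (auto simp: above_def add.commute)

text \<open>Multiply the linear relation of \<open>a\<close> by the variable of \<open>F\<close>. A
  flat that contains \<open>a\<close> but not the closure of \<open>insert a F\<close> does not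
  contain \<open>F\<close>, and it is not inside \<open>F\<close>; its term is thus a product of
  incomparable flats, or absent if \<open>F\<close> is empty.\<close>

lemma X'_Y_cl_insert_in_Ideal:
  assumes F: "F \<in> L" and a: "a \<in> E" "a \<notin> F"
  shows "X' F * Y (cl (insert a F)) \<in> Ideal"
proof -
  have sub: "insert a F \<subseteq> E" using F a flat_subset by auto
  have "{a} \<subseteq> cl (insert a F)" using subset_cl[OF sub] by auto
  then have "X' F * Y {a} = X' F * Y (cl (insert a F))
      + (\<Sum>G\<in>above {a} - above (cl (insert a F)). X' F * X G)"
    by (simp add: Y_split[of "{a}"] ring_distribs sum_distrib_left)
  then have "X' F * Y (cl (insert a F))
      = X' F * Y {a} - (\<Sum>G\<in>above {a} - above (cl (insert a F)). X' F * X G)"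
    by simp
  moreover have "X' F * X G \<in> Ideal" if "G \<in> above {a} - above (cl (insert a F))" for G
  proof -
    have G: "G \<in> L" "a \<in> G" and "\<not> cl (insert a F) \<subseteq> G"
      using that by (auto simp: above_def)
    then have "\<not> F \<subseteq> G"
      using cl_subset_iff[OF G(1) sub] by auto
    then show ?thesis
      using F G a Ideal_incomparable[of F G] by (auto simp: X'_def vars_iff)
  qed
  ultimately show ?thesis
    using Ideal_X'[OF F Ideal_atom[OF a(1)]] by (auto simp: Y_def intro!: Ideal_diff Ideal_sum)
qed

text \<open>After multiplication by \<open>X G\<close>, the terms by which \<open>Y F\<close>
  exceeds \<open>Y\<close> of the join belong to flats incomparable to \<open>G\<close>. Powers
  follow by telescoping.\<close>

lemma X_Y_power_join:
  assumes F: "F \<in> L" "F \<noteq> {}" and G: "G \<in> L" "G \<noteq> {}" and nsub: "\<not> F \<subseteq> G"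
  shows "X G * Y F ^ j - X G * Y (cl (F \<union> G)) ^ j \<in> Ideal"
proof -
  define V where "V = cl (F \<union> G)"
  have sub: "F \<union> G \<subseteq> E" using F G flat_subset by auto
  have V: "F \<subseteq> V" using subset_cl[OF sub] by (auto simp: V_def)
  then have "V \<noteq> {}" using F by auto
  have base: "X G * Y F - X G * Y V \<in> Ideal"
  proof -
    have "X G * Y F - X G * Y V = (\<Sum>H\<in>above F - above V. X G * X H)"
      by (simp add: Y_split[OF V] ring_distribs sum_distrib_left)
    moreover have "X G * X H \<in> Ideal" if "H \<in> above F - above V" for H
    proof (rule Ideal_incomparable)
      have H: "H \<in> L" "F \<subseteq> H" "\<not> V \<subseteq> H" using that by (auto simp: above_def)
      show "H \<in> vars" "G \<in> vars" using H F G by (auto simp: vars_iff)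
      show "\<not> G \<subseteq> H" using H cl_subset_iff[OF H(1) sub] by (auto simp: V_def)
      show "\<not> H \<subseteq> G" using H nsub by auto
    qed
    ultimately show ?thesis by (auto intro: Ideal_sum)
  qed
  have "X G * Y F ^ j - X G * Y V ^ j \<in> Ideal"
  proof (induction j)
    case (Suc j)
    have "X G * Y F ^ Suc j - X G * Y V ^ Suc j
        = Y F * (X G * Y F ^ j - X G * Y V ^ j) + Y V ^ j * (X G * Y F - X G * Y V)"
      by (simp add: algebra_simps)
    also have "\<dots> \<in> Ideal"
      using Ideal_add[OF Ideal_Y[OF F(2) Suc] Ideal_Y_power[OF \<open>V \<noteq> {}\<close> base, of j]] .
    finally show ?case .
  qed (simp add: Ideal_zero)
  then show ?thesis by (simp add: V_def)
qed

text \<open>Induction on the rank gap. With \<open>H\<close> one rank above \<open>F'\<close> and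
  inside \<open>F\<close>, the product \<open>X' F' * Y H\<close> lies in the ideal. Splitting
  \<open>Y H\<close> at \<open>F\<close> and multiplying by \<open>Y F ^ k\<close> leaves the wanted
  product and terms with \<open>X G * Y F ^ k\<close>, to which the induction hypothesis
  applies.\<close>

lemma X'_Y_power_in_Ideal:
  "F' \<in> L \<Longrightarrow> F \<in> L \<Longrightarrow> F' \<subset> F \<Longrightarrow> X' F' * Y F ^ (rk F - rk F') \<in> Ideal"
proof (induction "rk F - rk F'" arbitrary: F F' rule: less_induct)
  case less
  note F' = less.prems(1) and F = less.prems(2) and sub = less.prems(3)
  have F'E: "F' \<noteq> E" using proper_subflat[OF F F' sub] .
  have "F \<noteq> {}" using sub by auto
  obtain a where a: "a \<in> F" "a \<notin> F'" using sub by auto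
  have aE: "a \<in> E" using a F flat_subset by auto
  define H where "H = cl (insert a F')"
  have insE: "insert a F' \<subseteq> E" using aE F' flat_subset by auto
  have H: "H \<in> L" "insert a F' \<subseteq> H" "H \<subseteq> F"
    using cl_flat[OF insE] subset_cl[OF insE] cl_least[OF F, of "insert a F'"] a sub
    by (auto simp: H_def)
  have rkH: "rk H = Suc (rk F')"
    using a card_proper_flat[OF F' F'E] finite_flat[OF F']
    by (simp add: H_def rk_cl rk_proper[OF F' F'E]) (simp add: rk_def)
  obtain k where k: "rk F - rk F' = Suc k"
    using rk_strict_mono[OF F F' sub] by (metis Suc_diff_Suc)
  have XG: "X G * Y F ^ k \<in> Ideal" if "G \<in> above H - above F" for G
  proof -
    have G: "G \<in> L" "H \<subseteq> G" "\<not> F \<subseteq> G" "G \<noteq> {}" using that H by (auto simp: above_def)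
    show ?thesis
    proof (cases "G \<subseteq> F")
      case True
      then have GF: "G \<subset> F" using G by auto
      have "rk H \<le> rk G"
        using G(2) rk_strict_mono[OF G(1) H(1)] by (metis order_le_less psubsetI)
      then have le: "rk F - rk G \<le> k" using rkH k by simp
      then have "X' G * Y F ^ (rk F - rk G) \<in> Ideal"
        using less.hyps[OF _ G(1) F GF] k by simp
      then have "Y F ^ (k - (rk F - rk G)) * (X G * Y F ^ (rk F - rk G)) \<in> Ideal"
        using Ideal_Y_power[OF \<open>F \<noteq> {}\<close>] G by (simp add: X'_def)
      moreover have "Y F ^ (k - (rk F - rk G)) * (X G * Y F ^ (rk F - rk G)) = X G * Y F ^ k"
        using le by (simp add: mult.left_commute flip: power_add)
      ultimately show ?thesis by simp
    next
      case False
      \<comment> \<open>Here \<open>F\<close> and \<open>G\<close> are incomparable, and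
        \<open>Y F\<close> may be replaced by \<open>Y V\<close> for the join \<open>V\<close>.
        Since \<open>H\<close> lies in \<open>F \<inter> G\<close>, submodularity bounds the gap
        from \<open>G\<close> to \<open>V\<close> by \<open>k\<close>.\<close>
      define V where "V = cl (F \<union> G)"
      have E: "F \<noteq> E" "G \<noteq> E" using False G flat_subset F by auto
      have FGE: "F \<union> G \<subseteq> E" using flat_subset F G by auto
      have V: "V \<in> L" "G \<subset> V" "V \<noteq> {}"
        using cl_flat[OF FGE] subset_cl[OF FGE] G by (auto simp: V_def)
      have HE: "H \<noteq> E" using H E flat_subset F by auto
      have "card H \<le> card (F \<inter> G)"
        using H G finite_flat[OF F] by (intro card_mono) auto
      moreover have "card F + card G = card (F \<union> G) + card (F \<inter> G)"
        using card_Un_Int finite_flat F G by blast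
      moreover have "card H = Suc (rk F')" "rk F = card F" "rk G = card G"
        using rkH rk_proper[OF H(1) HE] rk_proper[OF F E(1)] rk_proper[OF G(1) E(2)] by auto
      moreover have "rk V \<le> card (F \<union> G)" by (simp add: V_def rk_cl) (simp add: rk_def)
      ultimately have le: "rk V - rk G \<le> k" using k by simp
      then have "X' G * Y V ^ (rk V - rk G) \<in> Ideal"
        using less.hyps[OF _ G(1) V(1,2)] k by simp
      then have "Y V ^ (k - (rk V - rk G)) * (X G * Y V ^ (rk V - rk G)) \<in> Ideal"
        using Ideal_Y_power[OF V(3)] G by (simp add: X'_def)
      moreover have "Y V ^ (k - (rk V - rk G)) * (X G * Y V ^ (rk V - rk G)) = X G * Y V ^ k"
        using le by (simp add: mult.left_commute flip: power_add)
      ultimately have "X G * Y V ^ k \<in> Ideal" by simp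
      from Ideal_add[OF X_Y_power_join[OF F \<open>F \<noteq> {}\<close> G(1,4,3), of k] this[unfolded V_def]]
      show ?thesis by simp
    qed
  qed
  have "Y F ^ k * (X' F' * Y H) \<in> Ideal"
    using Ideal_Y_power[OF \<open>F \<noteq> {}\<close>] X'_Y_cl_insert_in_Ideal[OF F' aE a(2)] by (simp add: H_def)
  moreover have "(\<Sum>G\<in>above H - above F. X' F' * (X G * Y F ^ k)) \<in> Ideal"
    by (intro Ideal_sum Ideal_X'[OF F'] XG)
  ultimately have "Y F ^ k * (X' F' * Y H) - (\<Sum>G\<in>above H - above F. X' F' * (X G * Y F ^ k)) \<in> Ideal"
    by (rule Ideal_diff)
  also have "Y F ^ k * (X' F' * Y H) - (\<Sum>G\<in>above H - above F. X' F' * (X G * Y F ^ k))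
      = X' F' * Y F ^ Suc k"
    by (simp add: Y_split[OF H(3)] algebra_simps sum_distrib_left sum_distrib_right)
  finally show ?case by (simp add: k)
qed

lemma lead_Y:
  assumes "F \<in> vars"
  shows "lead vars (Y F) {#F#} 1"
proof (rule leadI)
  have F: "F \<in> above F" using assms by (auto simp: above_def vars_iff)
  show "Y F = frag_of {#F#} + (\<Sum>G\<in>above F - {F}. X G)"
    unfolding Y_def using sum.remove[OF finite_above F] by blast
  fix k assume "k \<in> keys (\<Sum>G\<in>above F - {F}. X G)"
  then obtain G where G: "G \<in> above F - {F}" "k = {#G#}"
    using keys_sum_X[of "above F - {F}" k] finite_above by auto
  then have "F \<subset> G" "G \<in> L" by (auto simp: above_def)
  moreover have "card F < card G"
    using calculation psubset_card_mono[OF finite_flat] by blast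
  ultimately show "size k = size {#F#} \<and> set_mset k \<subseteq> vars \<and> weight {#F#} < weight k"
    using G by (auto simp: vars_iff)
qed (use assms in auto)

lemma pre_flat:
  assumes "set_mset m \<subseteq> vars" "\<forall>F\<in>#m. \<forall>G\<in>#m. F \<subseteq> G \<or> G \<subseteq> F" "F \<in># m"
  shows "pre m F \<in> insert {} (set_mset m)" "pre m F \<in> L" "pre m F \<subset> F"
proof -
  have "pre m F = {} \<or> pre m F \<in> {G \<in> set_mset m. G \<subset> F}"
  proof (cases "{G \<in> set_mset m. G \<subset> F} = {}")
    case True
    then show ?thesis unfolding pre_def by (simp only: Union_empty simp_thms)
  next
    case False
    then have "\<Union>{G \<in> set_mset m. G \<subset> F} \<in> {G \<in> set_mset m. G \<subset> F}"
      by (intro Union_chain_in) (use assms(2) in auto)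
    then show ?thesis unfolding pre_def by (rule disjI2)
  qed
  moreover have "F \<noteq> {}" using assms by (auto simp: vars_iff)
  ultimately show "pre m F \<in> insert {} (set_mset m)" "pre m F \<in> L" "pre m F \<subset> F"
    using assms(1) empty_flat by (auto simp: vars_iff)
qed

text \<open>If two flats of \<open>m\<close> are incomparable, \<open>m\<close> itself is in the
  ideal. Otherwise some exponent is too large, and \<open>m\<close> is a multiple of the leading
  monomial of the relation in \<open>X'_Y_power_in_Ideal\<close>.\<close>

lemma reducible:
  assumes m: "set_mset m \<subseteq> vars" "m \<notin> FY"
  shows "\<exists>p\<in>Ideal. lead vars p m 1"
proof (cases "\<forall>F\<in>#m. \<forall>G\<in>#m. F \<subseteq> G \<or> G \<subseteq> F")
  case False
  then obtain F G where FG: "F \<in># m" "G \<in># m" "\<not> F \<subseteq> G" "\<not> G \<subseteq> F" by blast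
  then have "G \<in># m - {#F#}" by (auto simp: in_diff_count)
  then obtain k where k: "m = add_mset F (add_mset G k)"
    using FG(1) by (metis insert_DiffM)
  have "frag_of k * (X F * X G) \<in> Ideal"
    using FG m k by (intro Ideal_monomial Ideal_incomparable) auto
  then have "frag_of m \<in> Ideal"
    by (simp add: k mult_single add_mset_commute)
  then show ?thesis using lead_single[OF m(1)] by blast
next
  case True
  then obtain F where F: "F \<in># m" "rk F \<le> count m F + rk (pre m F)"
    using m by (force simp: FY_def)
  define F' where "F' = pre m F"
  note F' = pre_flat[OF m(1) True F(1), folded F'_def]
  have FL: "F \<in> L" "F \<in> vars" using F m by (auto simp: vars_iff)
  define g where "g = rk F - rk F'"
  \<comment> \<open>The leading monomial of \<open>X' F'\<close>, which is 1 when \<open>F'\<close>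
    is empty.\<close>
  define h where "h = (if F' = {} then {#} else {#F'#})"
  have "replicate_mset g F + h \<subseteq># m"
  proof (rule mset_subset_eqI)
    fix x
    show "count (replicate_mset g F + h) x \<le> count m x"
      using F(2) F' by (auto simp: g_def h_def F'_def[symmetric] Suc_le_eq)
  qed
  then obtain k where k: "m = k + (h + replicate_mset g F)"
    by (metis add.commute subset_mset.diff_add)
  have "frag_of k * (X' F' * Y F ^ g) \<in> Ideal"
    unfolding g_def using m k by (intro Ideal_monomial X'_Y_power_in_Ideal F' FL) auto
  moreover have "lead vars (X' F') h 1"
    using lead_single[of "{#F'#}" vars 1] F'(2) by (auto simp: X'_def h_def lead_one vars_iff)
  then have "lead vars (frag_of k * (X' F' * Y F ^ g)) (k + (h + replicate_mset g F)) (1 * (1 * 1))"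
    by (intro lead_mult lead_single lead_power lead_Y FL) (use m k in auto)
  ultimately show ?thesis using k by auto
qed

lemma weight_le: "set_mset m \<subseteq> vars \<Longrightarrow> weight m \<le> size m * n"
proof (induction m)
  case (add F m)
  then have "card F \<le> n"
    using card_mono[OF finite_E flat_subset, of F] by (simp add: vars_iff card_E)
  with add show ?case by simp
qed simp

text \<open>Replace a monomial outside \<open>FY\<close> by the lower order terms of
  \<open>reducible\<close>. The leading coefficient 1 keeps all coefficients integral, and
  \<open>weight_le\<close> bounds the number of rounds.\<close>

lemma FY_span:
  "set_mset m \<subseteq> vars \<Longrightarrow> \<exists>e. (\<lambda>x. monomial_poly m x - e x) \<in> chow_ideal L {}
      \<and> (\<forall>x. e x \<noteq> 0 \<longrightarrow> x \<in> FY \<and> size x = size m)"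
proof (induction "size m * n - weight m" arbitrary: m rule: less_induct)
  case less
  show ?case
  proof (cases "m \<in> FY")
    case True
    then show ?thesis
      by (intro exI[of _ "monomial_poly m"])
         (auto simp: chow_ideal_def zspan.zero monomial_poly_def split: if_splits)
  next
    case False
    then obtain p s where p: "lookup p \<in> chow_ideal L {}" "p = frag_of m + s"
      and s: "\<And>k. k \<in> keys s \<Longrightarrow> size k = size m \<and> set_mset k \<subseteq> vars \<and> weight m < weight k"
      using reducible[OF less.prems] by (metis Ideal_def leadE mem_Collect_eq)
    have "\<exists>e. (\<lambda>x. monomial_poly k x - e x) \<in> chow_ideal L {}
        \<and> (\<forall>x. e x \<noteq> 0 \<longrightarrow> x \<in> FY \<and> size x = size m)" if "k \<in> keys s" for k
      using less.hyps[of k] s[OF that] weight_le[of k] by fastforce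
    then obtain e where e: "\<And>k. k \<in> keys s \<Longrightarrow> (\<lambda>x. monomial_poly k x - e k x) \<in> chow_ideal L {}"
      "\<And>k x. k \<in> keys s \<Longrightarrow> e k x \<noteq> 0 \<Longrightarrow> x \<in> FY \<and> size x = size m" by metis
    have "(\<lambda>x. \<Sum>k\<in>keys s. lookup s k * (monomial_poly k x - e k x)) \<in> chow_ideal L {}"
      using e(1) unfolding chow_ideal_def by (intro zspan_sum zspan_scale) auto
    then have "(\<lambda>x. lookup p x - (\<Sum>k\<in>keys s. lookup s k * (monomial_poly k x - e k x))) \<in> chow_ideal L {}"
      using p(1) unfolding chow_ideal_def by (intro zspan_diff)
    moreover have "(\<Sum>k\<in>keys s. lookup s k * monomial_poly k x) = lookup s x" for x
      by (rule fun_cong[OF finite_support_sum_monomials[of "keys s" "lookup s"], symmetric])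
         (simp_all add: in_keys_iff)
    then have "lookup p x - (\<Sum>k\<in>keys s. lookup s k * (monomial_poly k x - e k x))
        = monomial_poly m x - (- (\<Sum>k\<in>keys s. lookup s k * e k x))" for x
      by (simp add: p(2) lookup_add lookup_single_one right_diff_distrib sum_subtractf)
    ultimately have "(\<lambda>x. monomial_poly m x - (- (\<Sum>k\<in>keys s. lookup s k * e k x))) \<in> chow_ideal L {}"
      by simp
    then show ?thesis
      using e(2) combination_support[of "lookup s" e _ "keys s"]
      by (intro exI[of _ "\<lambda>x. - (\<Sum>k\<in>keys s. lookup s k * e k x)"]) (simp, blast)
  qed
qed

end

subsection \<open>Dragon Hall-Rado functionals\<close>

text \<open>The variables are distributed by \<open>\<tau>\<close> over segments, each carrying its own rank function \<open>\<rho> s\<close>.\<close>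
definition dragon :: "('v \<Rightarrow> 's) \<Rightarrow> ('s \<Rightarrow> 'v set \<Rightarrow> nat) \<Rightarrow> 'v multiset \<Rightarrow> bool" where
  "dragon \<tau> \<rho> k \<longleftrightarrow> (\<forall>s J. J \<subseteq># k \<longrightarrow> J \<noteq> {#} \<longrightarrow> (\<forall>x\<in>#J. \<tau> x = s) \<longrightarrow> size J < \<rho> s (set_mset J))"

lemma dragonD:
  assumes "dragon \<tau> \<rho> k" "J \<subseteq># k" "J \<noteq> {#}" "\<forall>x\<in>#J. \<tau> x = s"
  shows "size J < \<rho> s (set_mset J)"
  using assms unfolding dragon_def by simp

text \<open>The submultisets of \<open>add_mset x k\<close> are sorted by whether they contain
  \<open>x\<close>.\<close>

lemma dragon_add:
  "dragon \<tau> \<rho> (add_mset x k) \<longleftrightarrow> dragon \<tau> \<rho> k \<and>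
     (\<forall>J. J \<subseteq># k \<longrightarrow> (\<forall>y\<in>#J. \<tau> y = \<tau> x) \<longrightarrow> Suc (size J) < \<rho> (\<tau> x) (insert x (set_mset J)))"
  (is "?A \<longleftrightarrow> ?B \<and> ?C")
proof
  assume A: ?A
  have ?B
    unfolding dragon_def
  proof (intro allI impI)
    fix s J assume "J \<subseteq># k" "J \<noteq> {#}" "\<forall>x\<in>#J. \<tau> x = s"
    moreover have "J \<subseteq># add_mset x k"
      using calculation(1) by (rule subset_mset.order_trans) simp
    ultimately show "size J < \<rho> s (set_mset J)"
      using dragonD[OF A] by blast
  qed
  moreover have ?C
  proof (intro allI impI)
    fix J assume "J \<subseteq># k" "\<forall>y\<in>#J. \<tau> y = \<tau> x"
    then have "add_mset x J \<subseteq># add_mset x k" "\<forall>y\<in>#add_mset x J. \<tau> y = \<tau> x" by auto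
    then have "size (add_mset x J) < \<rho> (\<tau> x) (set_mset (add_mset x J))"
      by (intro dragonD[OF A]) simp_all
    then show "Suc (size J) < \<rho> (\<tau> x) (insert x (set_mset J))" by simp
  qed
  ultimately show "?B \<and> ?C" by blast
next
  assume BC: "?B \<and> ?C"
  show ?A
    unfolding dragon_def
  proof (intro allI impI)
    fix s J assume J: "J \<subseteq># add_mset x k" "J \<noteq> {#}" "\<forall>y\<in>#J. \<tau> y = s"
    show "size J < \<rho> s (set_mset J)"
    proof (cases "x \<in># J")
      case True
      then obtain J' where J': "J = add_mset x J'" by (metis insert_DiffM)
      have "J' \<subseteq># k" "\<forall>y\<in>#J'. \<tau> y = \<tau> x" using J by (auto simp: J')
      then show ?thesis using BC J by (simp add: J')
    next
      case False
      have "J \<subseteq># k"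
      proof (rule mset_subset_eqI)
        fix a
        show "count J a \<le> count k a"
          using mset_subset_eq_count[OF J(1), of a] False by (cases "a = x") (auto simp: not_in_iff)
      qed
      moreover have "dragon \<tau> \<rho> k" using BC by blast
      ultimately show ?thesis using J(2,3) by (intro dragonD)
    qed
  qed
qed

text \<open>Variables of one segment that are parallel for its rank function are
  interchangeable.\<close>

lemma dragon_cong:
  assumes "\<tau> x = \<tau> u" "\<And>A. \<rho> (\<tau> u) (insert x A) = \<rho> (\<tau> u) (insert u A)"
  shows "dragon \<tau> \<rho> (add_mset x k) \<longleftrightarrow> dragon \<tau> \<rho> (add_mset u k)"
  by (simp add: dragon_add assms)

lemma dragon_add_add:
  assumes "\<tau> x = s" "\<tau> y = s"
  shows "dragon \<tau> \<rho> (add_mset x (add_mset y k)) \<longleftrightarrow> dragon \<tau> \<rho> k \<and>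
     (\<forall>J. J \<subseteq># k \<longrightarrow> (\<forall>z\<in>#J. \<tau> z = s) \<longrightarrow> Suc (size J) < \<rho> s (insert x (set_mset J))) \<and>
     (\<forall>J. J \<subseteq># k \<longrightarrow> (\<forall>z\<in>#J. \<tau> z = s) \<longrightarrow> Suc (size J) < \<rho> s (insert y (set_mset J))) \<and>
     (\<forall>J. J \<subseteq># k \<longrightarrow> (\<forall>z\<in>#J. \<tau> z = s) \<longrightarrow> Suc (Suc (size J)) < \<rho> s (insert x (insert y (set_mset J))))"
  (is "?A \<longleftrightarrow> ?D \<and> ?X \<and> ?Y \<and> ?XY")
proof -
  have "?A \<longleftrightarrow> ?D \<and> ?Y \<and> (\<forall>J. J \<subseteq># add_mset y k \<longrightarrow> (\<forall>z\<in>#J. \<tau> z = s) \<longrightarrow>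
      Suc (size J) < \<rho> s (insert x (set_mset J)))" (is "_ \<longleftrightarrow> _ \<and> _ \<and> ?Z")
    by (simp add: dragon_add[of _ _ x] dragon_add[of _ _ y] assms)
  moreover have "?Z \<longleftrightarrow> ?X \<and> ?XY"
  proof
    assume Z: ?Z
    have ?X
    proof (intro allI impI)
      fix J assume "J \<subseteq># k" "\<forall>z\<in>#J. \<tau> z = s"
      moreover have "k \<subseteq># add_mset y k" by simp
      ultimately show "Suc (size J) < \<rho> s (insert x (set_mset J))"
        using Z subset_mset.order_trans by blast
    qed
    moreover have ?XY
    proof (intro allI impI)
      fix J assume "J \<subseteq># k" "\<forall>z\<in>#J. \<tau> z = s"
      then show "Suc (Suc (size J)) < \<rho> s (insert x (insert y (set_mset J)))"
        using Z[rule_format, of "add_mset y J"] assms by auto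
    qed
    ultimately show "?X \<and> ?XY" by blast
  next
    assume XY: "?X \<and> ?XY"
    show ?Z
    proof (intro allI impI)
      fix J assume J: "J \<subseteq># add_mset y k" "\<forall>z\<in>#J. \<tau> z = s"
      show "Suc (size J) < \<rho> s (insert x (set_mset J))"
      proof (cases "y \<in># J")
        case True
        then obtain J' where J': "J = add_mset y J'" by (metis insert_DiffM)
        have "J' \<subseteq># k" "\<forall>z\<in>#J'. \<tau> z = s" using J by (auto simp: J')
        then show ?thesis using XY by (simp add: J')
      next
        case False
        have "J \<subseteq># k"
        proof (rule mset_subset_eqI)
          fix a
          show "count J a \<le> count k a"
            using mset_subset_eq_count[OF J(1), of a] False by (cases "a = y") (auto simp: not_in_iff)
        qed
        then show ?thesis using XY J by blast
      qed
    qed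
  qed
  ultimately show ?thesis by blast
qed

lemma size_union_inter_mset: "size (J \<union># K) + size (J \<inter># K) = size J + size K"
proof -
  have "(J \<union># K) + (J \<inter># K) = J + K"
    by (rule multiset_eqI) auto
  then show ?thesis by (metis size_union)
qed

text \<open>Under the common condition \<open>d\<close>, the condition at \<open>u\<close> is
  automatic, so the alternating sum is the product of the indicators that \<open>f\<close> and
  \<open>g\<close> fail. Both cannot fail: by submodularity, violating multisets \<open>J\<close>
  for \<open>f\<close> and \<open>K\<close> for \<open>g\<close> would give a violation of
  \<open>d\<close> at their union.\<close>

lemma dragon_uncrossing:
  assumes s: "\<tau> f = s" "\<tau> g = s" "\<tau> u = s"
    and fg: "\<And>A. \<rho> s (insert f (insert g A)) = \<rho> s (insert u A)"
    and fu: "\<And>A. \<rho> s (insert f (insert u A)) = \<rho> s (insert u A)"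
    and ug: "\<And>A. \<rho> s (insert u (insert g A)) = \<rho> s (insert u A)"
    and submod: "\<And>A B. \<rho> s (insert u (A \<union> B)) + \<rho> s (A \<inter> B) \<le> \<rho> s (insert f A) + \<rho> s (insert g B)"
  shows "of_bool (dragon \<tau> \<rho> (add_mset f (add_mset g k))) - of_bool (dragon \<tau> \<rho> (add_mset f (add_mset u k)))
    - of_bool (dragon \<tau> \<rho> (add_mset u (add_mset g k))) + of_bool (dragon \<tau> \<rho> (add_mset u (add_mset u k))) = (0::int)"
proof -
  define c where "c x \<longleftrightarrow> (\<forall>J. J \<subseteq># k \<longrightarrow> (\<forall>z\<in>#J. \<tau> z = s) \<longrightarrow> Suc (size J) < \<rho> s (insert x (set_mset J)))" for x
  define d where "d \<longleftrightarrow> dragon \<tau> \<rho> k \<and>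
    (\<forall>J. J \<subseteq># k \<longrightarrow> (\<forall>z\<in>#J. \<tau> z = s) \<longrightarrow> Suc (Suc (size J)) < \<rho> s (insert u (set_mset J)))"
  have eqs: "dragon \<tau> \<rho> (add_mset f (add_mset g k)) \<longleftrightarrow> d \<and> c f \<and> c g"
    "dragon \<tau> \<rho> (add_mset f (add_mset u k)) \<longleftrightarrow> d \<and> c f \<and> c u"
    "dragon \<tau> \<rho> (add_mset u (add_mset g k)) \<longleftrightarrow> d \<and> c u \<and> c g"
    "dragon \<tau> \<rho> (add_mset u (add_mset u k)) \<longleftrightarrow> d \<and> c u"
    by (auto simp: dragon_add_add[of \<tau> _ s] s c_def d_def fg fu ug)
  have cu: "c u" if d
    using that unfolding d_def c_def using Suc_lessD by blast
  have "c f \<or> c g" if d: d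
  proof (rule ccontr)
    assume "\<not> (c f \<or> c g)"
    then obtain J K where J: "J \<subseteq># k" "\<forall>z\<in>#J. \<tau> z = s" "\<rho> s (insert f (set_mset J)) \<le> Suc (size J)"
      and K: "K \<subseteq># k" "\<forall>z\<in>#K. \<tau> z = s" "\<rho> s (insert g (set_mset K)) \<le> Suc (size K)"
      unfolding c_def not_less[symmetric] by blast
    have "J \<union># K \<subseteq># k"
      using J K by (simp add: mset_subset_eq_count mset_subset_eqI)
    moreover have "\<forall>z\<in>#J \<union># K. \<tau> z = s" using J K by auto
    ultimately have "Suc (Suc (size (J \<union># K))) < \<rho> s (insert u (set_mset J \<union> set_mset K))"
      using d unfolding d_def by (metis set_mset_sup)
    \<comment> \<open>Only the weak inequality is available, since the intersection may be empty;
      the strict bounds elsewhere leave room for it.\<close>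
    moreover have "size (J \<inter># K) \<le> \<rho> s (set_mset J \<inter> set_mset K)"
    proof (cases "J \<inter># K = {#}")
      case False
      moreover have "J \<inter># K \<subseteq># k" using J by (meson subset_mset.inf.coboundedI1)
      moreover have "\<forall>z\<in>#J \<inter># K. \<tau> z = s" using J by auto
      ultimately have "size (J \<inter># K) < \<rho> s (set_mset (J \<inter># K))"
        using d by (intro dragonD[of \<tau> \<rho> k]) (auto simp: d_def)
      then show ?thesis by simp
    qed simp
    ultimately show False
      using submod[of "set_mset J" "set_mset K"] J(3) K(3) size_union_inter_mset[of J K] by linarith
  qed
  then show ?thesis
    using cu by (auto simp: eqs)
qed

definition lin :: "('m \<Rightarrow> int) \<Rightarrow> ('m \<Rightarrow>\<^sub>0 int) \<Rightarrow> int" where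
  "lin \<phi> p = (\<Sum>k\<in>keys p. lookup p k * \<phi> k)"

lemma lin_add: "lin \<phi> (p + q) = lin \<phi> p + lin \<phi> q"
  unfolding lin_def by (rule setsum_keys_plus_distrib) (auto simp: algebra_simps)

lemma lin_zero [simp]: "lin \<phi> 0 = 0"
  by (simp add: lin_def)

lemma lin_uminus: "lin \<phi> (- p) = - lin \<phi> p"
  using lin_add[of \<phi> p "- p"] by simp

lemma lin_diff: "lin \<phi> (p - q) = lin \<phi> p - lin \<phi> q"
  using lin_add[of \<phi> p "- q"] by (simp add: lin_uminus)

lemma lin_sum: "lin \<phi> (sum f A) = (\<Sum>a\<in>A. lin \<phi> (f a))"
  by (induction A rule: infinite_finite_induct) (auto simp: lin_add)

lemma lin_single: "lin \<phi> (Poly_Mapping.single k c) = c * \<phi> k"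
  by (simp add: lin_def)

text \<open>By linearity it suffices to test monomial cofactors.\<close>

lemma lin_mult_zeroI:
  assumes "\<And>k. lin \<phi> (p * frag_of k) = 0"
  shows "lin \<phi> (p * w) = 0"
  using subset_refl[of "keys w"]
  by (rule frag_induction) (auto simp: assms right_diff_distrib lin_diff)

lemma weight_image_mset:
  "\<forall>G\<in>#k. finite (h G) \<and> G \<subseteq> h G \<Longrightarrow> weight k < weight (image_mset h k) \<or> image_mset h k = k"
proof (induction k)
  case (add G k)
  then have "card G \<le> card (h G)" "G \<noteq> h G \<Longrightarrow> card G < card (h G)"
    by (auto intro: card_mono psubset_card_mono)
  with add show ?case by fastforce
qed simp

lemma min_card_submodular:
  assumes "finite A" "finite B"
  shows "min (card (A \<union> B)) t + min (card (A \<inter> B)) t \<le> min (card A) t + min (card B) t"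
proof -
  have "card A + card B = card (A \<union> B) + card (A \<inter> B)"
    using assms by (rule card_Un_Int)
  moreover have "card (A \<inter> B) \<le> card A" "card (A \<inter> B) \<le> card B"
    using assms by (auto intro: card_mono)
  ultimately show ?thesis by linarith
qed

section \<open>Functionals attached to the basis monomials\<close>

context uniform_matroid
begin

text \<open>On a chain the intersection is the smallest member containing \<open>G\<close>. Adding
  \<open>E\<close> gives every flat a segment, also when \<open>b\<close> does not reach the
  top.\<close>

definition seg_top :: "nat set multiset \<Rightarrow> nat set \<Rightarrow> nat set" where
  "seg_top b G = \<Inter>{F \<in> insert E (set_mset b). G \<subseteq> F}"

text \<open>
  The rank function of the interval from \<open>pre b s\<close> to \<open>s\<close>, truncated. Truncation amounts to
  multiplying by the power of \<open>h\<^sub>s\<close> complementary to the exponent of \<open>s\<close> in \<open>b\<close>.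
\<close>
definition seg_rank :: "nat set multiset \<Rightarrow> nat set \<Rightarrow> nat set set \<Rightarrow> nat" where
  "seg_rank b s A = min (card (\<Union>A \<inter> E - pre b s)) (Suc (count b s))"

definition dhr :: "nat set multiset \<Rightarrow> nat set multiset \<Rightarrow> bool" where
  "dhr b k \<longleftrightarrow> dragon (seg_top b) (seg_rank b) k"

lemma FY_flat: "b \<in> FY \<Longrightarrow> F \<in> insert E (set_mset b) \<Longrightarrow> F \<in> L"
  using E_flat by (auto simp: FY_def vars_iff)

lemma FY_chain:
  assumes "b \<in> FY" "F \<in> insert E (set_mset b)" "G \<in> insert E (set_mset b)"
  shows "F \<subseteq> G \<or> G \<subseteq> F"
  using assms flat_subset[OF FY_flat[OF assms(1,2)]] flat_subset[OF FY_flat[OF assms(1,3)]]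
  unfolding FY_def by blast

lemma seg_top_in:
  assumes "b \<in> FY" "G \<subseteq> E"
  shows "seg_top b G \<in> insert E (set_mset b)" "G \<subseteq> seg_top b G"
proof -
  have "seg_top b G \<in> {F \<in> insert E (set_mset b). G \<subseteq> F}"
    unfolding seg_top_def by (rule Inter_chain_in) (use assms FY_chain in auto)
  then show "seg_top b G \<in> insert E (set_mset b)" "G \<subseteq> seg_top b G" by auto
qed

lemma seg_top_least: "F \<in> insert E (set_mset b) \<Longrightarrow> G \<subseteq> F \<Longrightarrow> seg_top b G \<subseteq> F"
  by (auto simp: seg_top_def)

lemma seg_top_self: "F \<in># b \<Longrightarrow> seg_top b F = F"
  by (auto simp: seg_top_def)

text \<open>The truncation level of a segment does not exceed its rank. If \<open>E\<close> is not
  in \<open>b\<close>, its exponent is 0 and the claim is that the top flat of \<open>b\<close> is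
  proper.\<close>

lemma pre_proper:
  assumes b: "b \<in> FY" and s: "s \<in> insert E (set_mset b)"
  shows "pre b s \<in> L" "pre b s \<subset> s" "card (pre b s) + Suc (count b s) \<le> rk s"
proof -
  have *: "pre b s \<in> L \<and> pre b s \<subset> s \<and> rk (pre b s) + Suc (count b s) \<le> rk s"
  proof (cases "s \<in># b")
    case True
    then show ?thesis using pre_flat[of b s] b by (auto simp: FY_def)
  next
    case False
    with s have sE: "s = E" by simp
    have "{G \<in> set_mset b. G \<subset> E} = set_mset b"
      using False FY_flat[OF b] flat_subset by (auto simp: sE)
    then have pre: "pre b s = \<Union>(set_mset b)" by (simp add: pre_def sE)
    have preL: "pre b s \<in> L" using FY_Union_flat[OF b] by (simp add: pre)
    moreover have "pre b s \<noteq> E"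
      unfolding pre using FY_Union[OF b] False E_nonempty sE by (cases "b = {#}") auto
    moreover have "pre b s \<subseteq> E"
      using calculation(1) flat_subset by blast
    ultimately have "pre b s \<subset> E" by blast
    then show ?thesis
      using rk_strict_mono[OF E_flat preL] preL False by (simp add: sE not_in_iff Suc_le_eq)
  qed
  then show "pre b s \<in> L" "pre b s \<subset> s" by auto
  moreover have "s \<subseteq> E" using FY_flat[OF b s] flat_subset by blast
  ultimately have "rk (pre b s) = card (pre b s)" by (intro rk_proper) auto
  with * show "card (pre b s) + Suc (count b s) \<le> rk s" by simp
qed

text \<open>Closure alters \<open>S\<close> only when \<open>S\<close> has at least \<open>r\<close>
  elements, and then both sides have reached the truncation level \<open>t\<close>.\<close>

lemma trunc_card_cl:
  assumes S: "S \<subseteq> E" and P: "finite P" "card P + t \<le> r"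
  shows "min (card ((cl S \<union> Z) \<inter> E - P)) t = min (card ((S \<union> Z) \<inter> E - P)) t"
proof (cases "card S < r")
  case True
  then show ?thesis by (simp add: cl_def)
next
  case False
  have "t \<le> card S - card P" using False P by linarith
  also have "\<dots> \<le> card (S - P)"
    by (rule diff_card_le_card_Diff[OF P(1)])
  also have "\<dots> \<le> card ((S \<union> Z) \<inter> E - P)"
    using S finite_E by (intro card_mono) auto
  finally have 1: "t \<le> card ((S \<union> Z) \<inter> E - P)" .
  also have "\<dots> \<le> card ((cl S \<union> Z) \<inter> E - P)"
    using S finite_E subset_cl[OF S] by (intro card_mono) auto
  finally show ?thesis using 1 by simp
qed

lemma seg_rank_insert_cl:
  assumes b: "b \<in> FY" and s: "s \<in> insert E (set_mset b)" and S: "S \<subseteq> E"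
  shows "seg_rank b s (insert (cl S) A) = min (card ((S \<union> \<Union>A) \<inter> E - pre b s)) (Suc (count b s))"
  using trunc_card_cl[OF S finite_flat[OF pre_proper(1)[OF b s]], of "Suc (count b s)" "\<Union>A"]
    pre_proper(3)[OF b s] rk_le[of s]
  by (simp add: seg_rank_def)

text \<open>A flat inside \<open>pre b s\<close> is contracted in the segment \<open>s\<close>, so
  joining it to \<open>G\<close> is invisible there.\<close>

lemma seg_rank_join_below:
  assumes b: "b \<in> FY" and s: "s \<in> insert E (set_mset b)"
    and FG: "F \<union> G \<subseteq> E" and F: "F \<subseteq> pre b s"
  shows "seg_rank b s (insert G A) = seg_rank b s (insert (cl (F \<union> G)) A)"
proof -
  have "(F \<union> G \<union> \<Union>A) \<inter> E - pre b s = \<Union>(insert G A) \<inter> E - pre b s"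
    using F by auto
  then show ?thesis
    unfolding seg_rank_insert_cl[OF b s FG] by (simp add: seg_rank_def)
qed

text \<open>If \<open>F\<close> and \<open>G\<close> lie in one segment, this is uncrossing for its
  submodular rank. Otherwise the flat in the higher segment is parallel to the join
  \<open>U\<close>, and the four terms cancel in pairs.\<close>

lemma dhr_uncrossing:
  assumes b: "b \<in> FY" and F: "F \<in> L" and G: "G \<in> L"
  defines "U \<equiv> cl (F \<union> G)"
  shows "of_bool (dhr b (add_mset F (add_mset G k))) - of_bool (dhr b (add_mset F (add_mset U k)))
    - of_bool (dhr b (add_mset U (add_mset G k))) + of_bool (dhr b (add_mset U (add_mset U k))) = (0::int)"
proof -
  have sub: "F \<subseteq> E" "G \<subseteq> E" "F \<union> G \<subseteq> E" using F G flat_subset by auto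
  have U: "U \<in> L" "F \<union> G \<subseteq> U" "U \<subseteq> E"
    using cl_flat[OF sub(3)] subset_cl[OF sub(3)] flat_subset by (auto simp: U_def)
  note tF = seg_top_in[OF b sub(1)] and tG = seg_top_in[OF b sub(2)] and tU = seg_top_in[OF b U(3)]
  have tFU: "seg_top b F \<subseteq> seg_top b U" "seg_top b G \<subseteq> seg_top b U"
    using seg_top_least[OF tU(1)] tU(2) U(2) by auto
  have tUle: "seg_top b U \<subseteq> s" if "s \<in> insert E (set_mset b)" "F \<subseteq> s" "G \<subseteq> s" for s
    using that cl_least[OF FY_flat[OF b that(1)], of "F \<union> G"] by (intro seg_top_least) (auto simp: U_def)
  \<comment> \<open>The join stays in the segment of \<open>G'\<close>, and \<open>F'\<close> lies
    below that segment.\<close>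
  have below: "dhr b (add_mset G' k') \<longleftrightarrow> dhr b (add_mset U k')"
    if FG': "F' \<union> G' = F \<union> G" and lt: "seg_top b F' \<subset> seg_top b G'" for F' G' k'
  proof -
    have sub': "F' \<subseteq> E" "G' \<subseteq> E" using FG' sub(3) by auto
    note tF' = seg_top_in[OF b sub'(1)] and tG' = seg_top_in[OF b sub'(2)]
    have "F \<union> G \<subseteq> seg_top b G'" using tF'(2) tG'(2) lt FG' by auto
    then have "seg_top b U \<subseteq> seg_top b G'" using tUle[OF tG'(1)] by auto
    moreover have "seg_top b G' \<subseteq> seg_top b U"
      using seg_top_least[OF tU(1)] tU(2) U(2) FG' by (metis Un_upper2 order_trans)
    ultimately have eq: "seg_top b G' = seg_top b U" by auto
    have "seg_top b G' \<subseteq> E" using flat_subset[OF FY_flat[OF b tG'(1)]] .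
    then have "seg_top b F' \<in># b" using tF'(1) lt by auto
    then have "seg_top b F' \<subseteq> pre b (seg_top b U)"
      using lt eq by (auto simp: pre_def)
    then have "F' \<subseteq> pre b (seg_top b U)" using tF'(2) by auto
    then show ?thesis
      unfolding dhr_def using seg_rank_join_below[OF b tU(1), of F' G'] FG' sub
      by (intro dragon_cong eq) (simp add: U_def)
  qed
  consider "seg_top b F = seg_top b G" | "seg_top b F \<subset> seg_top b G" | "seg_top b G \<subset> seg_top b F"
    using FY_chain[OF b tF(1) tG(1)] by auto
  then show ?thesis
  proof cases
    case 1
    define s where "s = seg_top b U"
    have "seg_top b U \<subseteq> seg_top b F" using tUle[OF tF(1) tF(2)] tG(2) 1 by simp
    then have s: "seg_top b F = s" "seg_top b G = s" "seg_top b U = s" using 1 tFU by (auto simp: s_def)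
    have sC: "s \<in> insert E (set_mset b)" using tU(1) by (simp add: s_def)
    note UA = seg_rank_insert_cl[OF b sC sub(3), folded U_def]
    show ?thesis
      unfolding dhr_def
    proof (rule dragon_uncrossing[where s = s])
      fix A B :: "nat set set"
      show "seg_rank b s (insert F (insert G A)) = seg_rank b s (insert U A)"
        unfolding UA by (simp add: seg_rank_def Un_assoc)
      have "F \<union> (U \<union> \<Union>A) = U \<union> \<Union>A" "U \<union> (G \<union> \<Union>A) = U \<union> \<Union>A"
        using U by auto
      then show "seg_rank b s (insert F (insert U A)) = seg_rank b s (insert U A)"
        "seg_rank b s (insert U (insert G A)) = seg_rank b s (insert U A)"
        by (simp_all add: seg_rank_def)
      \<comment> \<open>Submodularity is that of truncated cardinality. The union over
        \<open>A \<inter> B\<close> may be smaller than \<open>X1 \<inter> Y1\<close>, which only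
        helps.\<close>
      define X1 Y1 where "X1 = (F \<union> \<Union>A) \<inter> E - pre b s" and "Y1 = (G \<union> \<Union>B) \<inter> E - pre b s"
      have fin: "finite X1" "finite Y1" using finite_E by (auto simp: X1_def Y1_def)
      have "seg_rank b s (insert U (A \<union> B)) = min (card (X1 \<union> Y1)) (Suc (count b s))"
        unfolding UA X1_def Y1_def by (rule arg_cong[of _ _ "\<lambda>Z. min (card Z) _"]) auto
      moreover have "card (\<Union>(A \<inter> B) \<inter> E - pre b s) \<le> card (X1 \<inter> Y1)"
        using fin by (intro card_mono) (auto simp: X1_def Y1_def)
      then have "seg_rank b s (A \<inter> B) \<le> min (card (X1 \<inter> Y1)) (Suc (count b s))"
        by (simp add: seg_rank_def min.coboundedI1)
      moreover have "seg_rank b s (insert F A) = min (card X1) (Suc (count b s))"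
        "seg_rank b s (insert G B) = min (card Y1) (Suc (count b s))"
        by (simp_all add: seg_rank_def X1_def Y1_def)
      ultimately show "seg_rank b s (insert U (A \<union> B)) + seg_rank b s (A \<inter> B)
          \<le> seg_rank b s (insert F A) + seg_rank b s (insert G B)"
        using min_card_submodular[OF fin, of "Suc (count b s)"] by linarith
    qed (use s in auto)
  next
    case 2
    then show ?thesis
      using below[of F G "add_mset F k"] below[of F G "add_mset U k"]
      by (simp add: add_mset_commute)
  next
    case 3
    then show ?thesis
      using below[of G F "add_mset G k"] below[of G F "add_mset U k"]
      by (simp add: add_mset_commute Un_commute)
  qed
qed

lemma atom_small:
  assumes "A \<in> lattice_atoms L {}"
  shows "A \<in> L" "A \<noteq> {}" "card A \<le> 1 \<or> r = 1"
proof -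
  show A: "A \<in> L" "A \<noteq> {}" using assms by (auto simp: lattice_atoms_def)
  show "card A \<le> 1 \<or> r = 1"
  proof (rule disjCI)
    assume "r \<noteq> 1"
    then have r: "1 < r" using r_pos by simp
    obtain a where a: "a \<in> A" using A by auto
    have "{a} \<in> L" using a A flat_subset r by (auto simp: flat_iff)
    then have "\<not> {a} \<subset> A" using assms by (auto simp: lattice_atoms_def)
    then have "A = {a}" using a by auto
    then show "card A \<le> 1" by simp
  qed
qed

text \<open>The single flat \<open>A\<close> already violates the condition: its segment rank is at
  most 1, by its size if \<open>r > 1\<close> and by the truncation if \<open>r = 1\<close>.\<close>

lemma not_dhr_atom:
  assumes b: "b \<in> FY" and A: "A \<in> lattice_atoms L {}"
  shows "\<not> dhr b (add_mset A k)"
proof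
  assume "dhr b (add_mset A k)"
  then have "1 < seg_rank b (seg_top b A) {A}"
    unfolding dhr_def dragon_add by (auto dest!: conjunct2 spec[of _ "{#}"])
  then have "1 < card (A \<inter> E - pre b (seg_top b A))" "1 \<le> count b (seg_top b A)"
    by (auto simp: seg_rank_def)
  moreover have "card (A \<inter> E - pre b (seg_top b A)) \<le> card A"
    using finite_flat[OF atom_small(1)[OF A]] by (intro card_mono) auto
  moreover have "Suc (count b (seg_top b A)) \<le> r"
    using pre_proper(3)[OF b seg_top_in(1)[OF b flat_subset[OF atom_small(1)[OF A]]]] rk_le[of "seg_top b A"]
    by linarith
  ultimately show False using atom_small(3)[OF A] by linarith
qed

text \<open>The truncation allows at most \<open>count b s\<close> flats of \<open>k\<close> in
  segment \<open>s\<close>. Equal degrees make all these bounds sharp, so moving every flat up to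
  the top of its segment turns \<open>k\<close> into \<open>b\<close>.\<close>

lemma dhr_weight:
  assumes b: "b \<in> FY" and k: "set_mset k \<subseteq> vars" "size k = size b" and dhr: "dhr b k"
  shows "weight k < weight b \<or> k = b"
proof -
  have "image_mset (seg_top b) k \<subseteq># b"
  proof (rule mset_subset_eqI)
    fix s
    define J where "J = filter_mset (\<lambda>G. seg_top b G = s) k"
    have "count (image_mset (seg_top b) k) s = size J"
      unfolding J_def by (induction k) auto
    moreover have "size J \<le> count b s"
    proof (cases "J = {#}")
      case False
      moreover have "J \<subseteq># k" "\<forall>G\<in>#J. seg_top b G = s" by (auto simp: J_def)
      ultimately have "size J < seg_rank b s (set_mset J)"
        using dhr by (intro dragonD[of "seg_top b" "seg_rank b" k]) (auto simp: dhr_def)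
      then show ?thesis by (simp add: seg_rank_def)
    qed simp
    ultimately show "count (image_mset (seg_top b) k) s \<le> count b s" by simp
  qed
  then have "image_mset (seg_top b) k = b"
    using k(2) mset_subset_size[of "image_mset (seg_top b) k" b] by (auto simp: subset_mset.less_le)
  moreover have "\<forall>G\<in>#k. finite (seg_top b G) \<and> G \<subseteq> seg_top b G"
  proof
    fix G assume "G \<in># k"
    then have "G \<in> vars" using k(1) by auto
    then have "G \<subseteq> E" using flat_subset by (simp add: vars_iff)
    from seg_top_in[OF b this] show "finite (seg_top b G) \<and> G \<subseteq> seg_top b G"
      using FY_flat[OF b] finite_flat by blast
  qed
  ultimately show ?thesis using weight_image_mset[of k "seg_top b"] by auto
qed

text \<open>Within one segment only powers of its top \<open>s\<close> occur in \<open>b\<close>,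
  and the rank of the segment reaches the full truncation level, one more than the exponent.\<close>

lemma dhr_self:
  assumes b: "b \<in> FY"
  shows "dhr b b"
  unfolding dhr_def dragon_def
proof (intro allI impI)
  fix s J assume J: "J \<subseteq># b" "J \<noteq> {#}" "\<forall>G\<in>#J. seg_top b G = s"
  have Js: "G = s" if "G \<in># J" for G
    using J that seg_top_self[of G b] mset_subset_eqD by fastforce
  then have set: "set_mset J = {s}" using J(2) by auto
  then have sb: "s \<in># b" using J(1) mset_subset_eqD by fastforce
  have "J = replicate_mset (size J) s"
    using Js by (metis set_mset_subset_singletonD set subset_refl)
  then have "size J = count J s" by (metis count_replicate_mset)
  then have size: "size J \<le> count b s" using mset_subset_eq_count[OF J(1)] by simp
  have sC: "s \<in> insert E (set_mset b)" using sb by simp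
  note p = pre_proper[OF b sC]
  have "s \<subseteq> E" using FY_flat[OF b sC] flat_subset by blast
  then have "card (\<Union>(set_mset J) \<inter> E - pre b s) = card (s - pre b s)"
    by (simp add: set Int_absorb2)
  also have "\<dots> = card s - card (pre b s)"
    using p finite_flat[OF p(1)] by (intro card_Diff_subset) auto
  also have "\<dots> \<ge> Suc (count b s)"
    using p(3) unfolding rk_def by linarith
  finally show "size J < seg_rank b s (set_mset J)"
    using size unfolding seg_rank_def by linarith
qed

subsection \<open>Independence\<close>

text \<open>
  The expression of \<open>x\<^sub>F\<close> in the variables \<open>h\<^sub>G\<close>, obtained by solving \<open>h\<^sub>F = - (\<Sum>G\<in>above F. x\<^sub>G)\<close> from
  the top; here \<open>X G\<close> stands for \<open>h\<^sub>G\<close>.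
\<close>
function subst_var :: "nat set \<Rightarrow> nat set multiset \<Rightarrow>\<^sub>0 int" where
  "subst_var F = - X F - (\<Sum>G\<in>above F - {F}. subst_var G)"
  by auto
termination
proof (relation "measure (\<lambda>F. card {G \<in> L. F \<subset> G})")
  fix F G assume "G \<in> above F - {F}"
  then have "{H \<in> L. G \<subset> H} \<subset> {H \<in> L. F \<subset> H}" by (auto simp: above_def)
  then show "(G, F) \<in> measure (\<lambda>F. card {G \<in> L. F \<subset> G})"
    using psubset_card_mono[of "{H \<in> L. F \<subset> H}" "{H \<in> L. G \<subset> H}"] finite_L by simp
qed simp

declare subst_var.simps [simp del]

text \<open>Confirms that the substitution inverts the change of variables: it sends
  \<open>Y F\<close> to minus the new variable of \<open>F\<close>.\<close>

lemma sum_subst_var_above: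
  assumes "F \<in> L"
  shows "(\<Sum>G\<in>above F. subst_var G) = - X F"
proof -
  have "F \<in> above F" using assms by (simp add: above_def)
  then have "(\<Sum>G\<in>above F. subst_var G) = subst_var F + (\<Sum>G\<in>above F - {F}. subst_var G)"
    using finite_above by (simp add: sum.remove)
  then show ?thesis by (simp add: subst_var.simps[of F])
qed

lemma lead_subst_var: "F \<in> vars \<Longrightarrow> lead vars (subst_var F) {#F#} (-1)"
proof (induction F rule: subst_var.induct)
  case (1 F)
  show ?case
  proof (rule leadI)
    show "subst_var F = Poly_Mapping.single {#F#} (-1) + - (\<Sum>G\<in>above F - {F}. subst_var G)"
      by (simp add: subst_var.simps[of F] single_uminus)
    fix k assume "k \<in> keys (- (\<Sum>G\<in>above F - {F}. subst_var G))"
    then have "k \<in> keys (\<Sum>G\<in>above F - {F}. subst_var G)" by (simp add: in_keys_iff)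
    then obtain G where G: "G \<in> above F - {F}" "k \<in> keys (subst_var G)"
      using keys_sum[of subst_var "above F - {F}"] by auto
    have GV: "G \<in> vars" "F \<subset> G" using G 1 by (auto simp: above_def vars_iff)
    then have card: "card F < card G"
      by (intro psubset_card_mono) (auto simp: vars_iff finite_flat)
    obtain s where s: "subst_var G = Poly_Mapping.single {#G#} (-1) + s"
      "\<And>k. k \<in> keys s \<Longrightarrow> size k = size {#G#} \<and> set_mset k \<subseteq> vars \<and> weight {#G#} < weight k"
      using leadE[OF 1(1)[OF G(1) GV(1)]] by metis
    have "k = {#G#} \<or> k \<in> keys s"
      using G(2) keys_add[of "Poly_Mapping.single {#G#} (-1)" s] by (auto simp: s(1) split: if_splits)
    then show "size k = size {#F#} \<and> set_mset k \<subseteq> vars \<and> weight {#F#} < weight k"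
      using GV(1) card s(2)[of k] by auto
  qed (use 1 in auto)
qed

definition subst_mono :: "nat set multiset \<Rightarrow> nat set multiset \<Rightarrow>\<^sub>0 int" where
  "subst_mono m = prod_mset (image_mset subst_var m)"

lemma subst_mono_add [simp]: "subst_mono (add_mset F m) = subst_var F * subst_mono m"
  by (simp add: subst_mono_def)

lemma lead_subst_mono: "set_mset m \<subseteq> vars \<Longrightarrow> lead vars (subst_mono m) m ((-1) ^ size m)"
proof (induction m)
  case empty
  then show ?case by (simp add: subst_mono_def lead_one)
next
  case (add F m)
  then show ?case
    using lead_mult[OF lead_subst_var[of F], of "subst_mono m" m "(-1) ^ size m"] by simp
qed

text \<open>Acts on polynomials in the new variables; composed with \<open>subst_mono\<close> it
  evaluates polynomials in the original ones.\<close>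

definition \<Lambda> :: "nat set multiset \<Rightarrow> (nat set multiset \<Rightarrow>\<^sub>0 int) \<Rightarrow> int" where
  "\<Lambda> b = lin (\<lambda>k. of_bool (dhr b k))"

lemma \<Lambda>_join:
  assumes b: "b \<in> FY" and F: "F \<in> L" and G: "G \<in> L"
  shows "\<Lambda> b ((X F - X (cl (F \<union> G))) * (X G - X (cl (F \<union> G))) * w) = 0"
  unfolding \<Lambda>_def
proof (rule lin_mult_zeroI)
  fix k
  define U where "U = cl (F \<union> G)"
  have "(X F - X U) * (X G - X U) * frag_of k
      = frag_of (add_mset F (add_mset G k)) - frag_of (add_mset F (add_mset U k))
      - frag_of (add_mset U (add_mset G k)) + frag_of (add_mset U (add_mset U k))"
    by (simp add: left_diff_distrib right_diff_distrib mult_single add_mset_commute)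
  then show "lin (\<lambda>k. of_bool (dhr b k)) ((X F - X (cl (F \<union> G))) * (X G - X (cl (F \<union> G))) * frag_of k) = 0"
    using dhr_uncrossing[OF b F G, of k]
    by (simp only: U_def[symmetric] lin_add lin_diff lin_single mult_1)
qed

text \<open>In \<open>\<Lambda>_join\<close> each difference of new variables is minus a sum of
  original ones, over flats above \<open>F\<close> (or \<open>G\<close>) but not above the join.
  Expanding gives products for pairs \<open>F'\<close>, \<open>G'\<close>; all pairs but
  \<open>F\<close>, \<open>G\<close> itself consist of larger flats and vanish by induction.\<close>

lemma \<Lambda>_incomparable:
  assumes b: "b \<in> FY"
  shows "F \<in> L \<Longrightarrow> G \<in> L \<Longrightarrow> \<not> F \<subseteq> G \<Longrightarrow> \<not> G \<subseteq> F \<Longrightarrow> \<Lambda> b (subst_var F * subst_var G * w) = 0"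
proof (induction "2 * n - (card F + card G)" arbitrary: F G rule: less_induct)
  case less
  note F = less.prems(1) and G = less.prems(2)
  define U where "U = cl (F \<union> G)"
  have sub: "F \<union> G \<subseteq> E" using F G flat_subset by auto
  have U: "U \<in> L" "F \<subseteq> U" "G \<subseteq> U" "\<And>H. H \<in> L \<Longrightarrow> F \<subseteq> H \<Longrightarrow> G \<subseteq> H \<Longrightarrow> U \<subseteq> H"
    using cl_flat[OF sub] subset_cl[OF sub] cl_least[of _ "F \<union> G"] by (auto simp: U_def)
  define A where "A F = above F - above U" for F
  have diff: "X H - X U = - (\<Sum>F'\<in>A H. subst_var F')" if "H \<in> L" "H \<subseteq> U" for H
  proof -
    have "above U \<subseteq> above H" using that by (auto simp: above_def)
    then have "(\<Sum>F'\<in>A H. subst_var F') = (\<Sum>F'\<in>above H. subst_var F') - (\<Sum>F'\<in>above U. subst_var F')"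
      unfolding A_def using finite_above by (intro sum_diff) auto
    then show ?thesis using sum_subst_var_above[OF that(1)] sum_subst_var_above[OF U(1)] by simp
  qed
  have fin: "finite (A F \<times> A G)" using finite_above by (simp add: A_def)
  have "(X F - X U) * (X G - X U) * w = (\<Sum>(F', G')\<in>A F \<times> A G. subst_var F' * subst_var G' * w)"
    unfolding diff[OF F U(2)] diff[OF G U(3)]
    unfolding minus_mult_minus sum_product sum.cartesian_product
    by (simp add: sum_distrib_right case_prod_unfold)
  then have "0 = (\<Sum>(F', G')\<in>A F \<times> A G. \<Lambda> b (subst_var F' * subst_var G' * w))"
    using \<Lambda>_join[OF b F G, of w] by (simp add: U_def[symmetric] \<Lambda>_def lin_sum case_prod_unfold)
  also have "\<dots> = (\<Sum>(F', G')\<in>{(F, G)}. \<Lambda> b (subst_var F' * subst_var G' * w))"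
  proof (rule sum.mono_neutral_right[OF fin])
    show "{(F, G)} \<subseteq> A F \<times> A G"
      using F G U less.prems by (auto simp: A_def above_def)
    show "\<forall>x\<in>A F \<times> A G - {(F, G)}. (case x of (F', G') \<Rightarrow> \<Lambda> b (subst_var F' * subst_var G' * w)) = 0"
    proof
      fix x assume x: "x \<in> A F \<times> A G - {(F, G)}"
      obtain F' G' where x': "x = (F', G')" by (cases x)
      have F': "F' \<in> L" "F \<subseteq> F'" "\<not> U \<subseteq> F'" and G': "G' \<in> L" "G \<subseteq> G'" "\<not> U \<subseteq> G'"
        using x by (auto simp: x' A_def above_def)
      \<comment> \<open>A containment between \<open>F'\<close> and \<open>G'\<close> would put the
        larger one above both \<open>F\<close> and \<open>G\<close>, hence above
        \<open>U\<close>.\<close>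
      have inc: "\<not> F' \<subseteq> G'" "\<not> G' \<subseteq> F'"
        using F' G' U(4)[of F'] U(4)[of G'] by auto
      have "card F \<le> card F'" "card G \<le> card G'"
        using F' G' finite_flat by (auto intro: card_mono)
      moreover have "F' \<noteq> F \<or> G' \<noteq> G" using x by (auto simp: x')
      then have "card F < card F' \<or> card G < card G'"
        using F' G' finite_flat by (metis psubsetI psubset_card_mono)
      moreover have "card F' \<le> n" "card G' \<le> n"
        using card_mono[OF finite_E flat_subset] F' G' card_E by auto
      ultimately have "2 * n - (card F' + card G') < 2 * n - (card F + card G)" by linarith
      from less.hyps[OF this F'(1) G'(1) inc] show "(case x of (F', G') \<Rightarrow> \<Lambda> b (subst_var F' * subst_var G' * w)) = 0"
        by (simp add: x')
    qed
  qed
  finally show ?case by simp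
qed

lemma \<Lambda>_atom:
  assumes b: "b \<in> FY" and A: "A \<in> lattice_atoms L {}"
  shows "\<Lambda> b ((\<Sum>G\<in>above A. subst_var G) * w) = 0"
  unfolding \<Lambda>_def
proof (rule lin_mult_zeroI)
  fix k
  show "lin (\<lambda>k. of_bool (dhr b k)) ((\<Sum>G\<in>above A. subst_var G) * frag_of k) = 0"
    using not_dhr_atom[OF b A, of k]
    by (simp add: sum_subst_var_above[OF atom_small(1)[OF A]] lin_uminus lin_single mult_single)
qed

text \<open>Members of the ideal are bare functions, so the induction also provides the finitely
  supported \<open>p\<close> on which the functional is evaluated.\<close>

lemma \<Lambda>_chow_ideal:
  assumes b: "b \<in> FY" and f: "f \<in> chow_ideal L {}"
  shows "\<exists>p. f = lookup p \<and> lin (\<lambda>m. \<Lambda> b (subst_mono m)) p = 0"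
  using f unfolding chow_ideal_def
proof (induction rule: zspan.induct)
  case zero
  show ?case by (intro exI[of _ 0]) (auto simp: zero_poly_mapping.rep_eq)
next
  case (gen h)
  then obtain m g where h: "h = mono_mult m g" and m: "set_mset m \<subseteq> vars" and g: "g \<in> chow_gens L {}"
    by blast
  from g consider F G where "g = monomial_poly {#F, G#}" "F \<in> vars" "G \<in> vars" "\<not> F \<subseteq> G" "\<not> G \<subseteq> F"
    | A where "g = (\<lambda>m. if \<exists>F. m = {#F#} \<and> F \<in> vars \<and> A \<subseteq> F then 1 else 0)" "A \<in> lattice_atoms L {}"
    unfolding chow_gens_def by blast
  then show ?case
  proof cases
    case 1
    have "lin (\<lambda>m. \<Lambda> b (subst_mono m)) (frag_of (m + {#F, G#})) = 0"
      using \<Lambda>_incomparable[OF b, of F G "subst_mono m"] 1 by (simp add: lin_single vars_iff mult.assoc)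
    then show ?thesis
      by (intro exI[of _ "frag_of (m + {#F, G#})"]) (simp add: h 1 mono_mult_monomial lookup_single_one)
  next
    case 2
    have "(\<exists>F. k = {#F#} \<and> F \<in> vars \<and> A \<subseteq> F) \<longleftrightarrow> (\<exists>F. k = {#F#} \<and> F \<in> above A)" for k
      using atom_small(2)[OF 2(2)] by (auto simp: above_def vars_iff)
    then have "g = lookup (\<Sum>G\<in>above A. X G)"
      unfolding lookup_sum_X[OF finite_above] 2(1) by simp
    then have "h = lookup (frag_of m * (\<Sum>G\<in>above A. X G))"
      by (simp add: h lookup_single_times)
    moreover have "lin (\<lambda>m. \<Lambda> b (subst_mono m)) (frag_of m * (\<Sum>G\<in>above A. X G))
        = (\<Sum>G\<in>above A. \<Lambda> b (subst_var G * subst_mono m))"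
      by (simp add: sum_distrib_left mult_single lin_sum lin_single)
    moreover have "\<dots> = 0"
      using \<Lambda>_atom[OF b 2(2), of "subst_mono m"] by (simp add: sum_distrib_right \<Lambda>_def lin_sum)
    ultimately show ?thesis by metis
  qed
next
  case (add f g)
  then obtain p q where "f = lookup p" "lin (\<lambda>m. \<Lambda> b (subst_mono m)) p = 0"
    "g = lookup q" "lin (\<lambda>m. \<Lambda> b (subst_mono m)) q = 0" by blast
  then show ?case by (intro exI[of _ "p + q"]) (simp add: plus_poly_mapping.rep_eq lin_add)
next
  case (neg f)
  then obtain p where "f = lookup p" "lin (\<lambda>m. \<Lambda> b (subst_mono m)) p = 0" by blast
  then show ?case by (intro exI[of _ "- p"]) (simp add: uminus_poly_mapping.rep_eq lin_uminus)
qed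

text \<open>Triangularity: if \<open>m\<close> is at least as heavy as \<open>b\<close>, the lower
  order terms of \<open>subst_mono m\<close> are heavier than \<open>b\<close> and fail the
  condition by \<open>dhr_weight\<close>.\<close>

lemma \<Lambda>_subst_mono:
  assumes b: "b \<in> FY" and m: "set_mset m \<subseteq> vars" "size m = size b"
  shows "\<Lambda> b (subst_mono m) \<noteq> 0 \<Longrightarrow> m = b \<or> weight m < weight b"
    and "m = b \<Longrightarrow> \<Lambda> b (subst_mono m) \<noteq> 0"
proof -
  obtain s where s: "subst_mono m = Poly_Mapping.single m ((-1) ^ size m) + s"
    "\<And>k. k \<in> keys s \<Longrightarrow> size k = size m \<and> set_mset k \<subseteq> vars \<and> weight m < weight k"
    using leadE[OF lead_subst_mono[OF m(1)]] by metis
  have \<Lambda>: "\<Lambda> b (subst_mono m) = (-1) ^ size m * of_bool (dhr b m) + \<Lambda> b s"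
    by (simp add: s(1) \<Lambda>_def lin_add lin_single)
  have zero: "\<Lambda> b s = 0" if "\<not> weight m < weight b"
    unfolding \<Lambda>_def lin_def
  proof (rule sum.neutral, rule)
    fix k assume "k \<in> keys s"
    then have "\<not> dhr b k"
      using dhr_weight[OF b, of k] s(2)[of k] m that by auto
    then show "lookup s k * of_bool (dhr b k) = 0" by simp
  qed
  show "m = b \<or> weight m < weight b" if "\<Lambda> b (subst_mono m) \<noteq> 0"
    using that \<Lambda> zero dhr_weight[OF b m] by auto
  show "\<Lambda> b (subst_mono m) \<noteq> 0" if "m = b"
    using that \<Lambda> zero dhr_self[OF b] by simp
qed

text \<open>Take \<open>b\<close> of least weight in the support. By triangularity its functional
  annihilates all other monomials of the support, so the coefficient at \<open>b\<close> would have
  to vanish.\<close>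

lemma FY_independent:
  assumes f: "f \<in> chow_ideal L {}" and supp: "\<And>m. f m \<noteq> 0 \<Longrightarrow> m \<in> FY \<and> size m = d"
  shows "f = (\<lambda>_. 0)"
proof (rule ccontr)
  assume "f \<noteq> (\<lambda>_. 0)"
  then have "\<exists>b. f b \<noteq> 0" by auto
  then obtain b where b: "f b \<noteq> 0" "\<And>m. f m \<noteq> 0 \<Longrightarrow> weight b \<le> weight m"
    using ex_has_least_nat[of "\<lambda>m. f m \<noteq> 0" _ weight] by blast
  have bFY: "b \<in> FY" "size b = d" using supp b(1) by auto
  obtain p where p: "f = lookup p" "lin (\<lambda>m. \<Lambda> b (subst_mono m)) p = 0"
    using \<Lambda>_chow_ideal[OF bFY(1) f] by blast
  have "lin (\<lambda>m. \<Lambda> b (subst_mono m)) p = (\<Sum>k\<in>{b}. f k * \<Lambda> b (subst_mono k))"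
    unfolding lin_def p(1)
  proof (rule sum.mono_neutral_right)
    show "{b} \<subseteq> keys p" using b(1) p(1) by (simp add: in_keys_iff)
    show "\<forall>k\<in>keys p - {b}. lookup p k * \<Lambda> b (subst_mono k) = 0"
    proof
      fix k assume k: "k \<in> keys p - {b}"
      then have fk: "f k \<noteq> 0" by (simp add: p(1) in_keys_iff)
      have kV: "set_mset k \<subseteq> vars" "size k = size b"
        using supp[OF fk] bFY by (auto simp: FY_def)
      have "\<not> (k = b \<or> weight k < weight b)"
        using k b(2)[OF fk] by auto
      then have "\<Lambda> b (subst_mono k) = 0"
        using \<Lambda>_subst_mono(1)[OF bFY(1) kV] by blast
      then show "lookup p k * \<Lambda> b (subst_mono k) = 0" by simp
    qed
  qed simp
  moreover have "\<Lambda> b (subst_mono b) \<noteq> 0"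
    using \<Lambda>_subst_mono(2)[OF bFY(1) _ refl refl] bFY(1) by (simp add: FY_def)
  ultimately show False using p(2) b(1) by simp
qed

section \<open>Graded ranks and the Hilbert series\<close>

lemma chow_rank_eq: "chow_rank L {} d = card {m \<in> FY. size m = d}"
proof (rule chow_rank_eqI)
  show "finite {m \<in> FY. size m = d}" using finite_FY by simp
  show "\<And>m. m \<in> {m \<in> FY. size m = d} \<Longrightarrow> size m = d \<and> set_mset m \<subseteq> vars"
    by (simp add: FY_def)
  show "\<exists>e. (\<lambda>x. monomial_poly m x - e x) \<in> chow_ideal L {} \<and> (\<forall>x. e x \<noteq> 0 \<longrightarrow> x \<in> {m \<in> FY. size m = d})"
    if "size m = d" "set_mset m \<subseteq> vars" for m
    using FY_span[OF that(2)] that(1) by simp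
  show "f = (\<lambda>_. 0)"
    if "f \<in> chow_ideal L {}" "\<And>m. f m \<noteq> 0 \<Longrightarrow> m \<in> {m \<in> FY. size m = d}" for f
    using FY_independent[OF that(1), of d] that(2) by simp
qed

lemma chow_hilbert_eq: "chow_hilbert L {} t = (\<Sum>m\<in>FY. t ^ size m)"
proof -
  have "chow_hilbert L {} t = (\<Sum>d\<in>size ` FY. int (chow_rank L {} d) * t ^ d)"
    unfolding chow_hilbert_def
  proof (rule sum.mono_neutral_cong_left)
    show "{d. chow_rank L {} d \<noteq> 0} \<subseteq> size ` FY"
      by (auto simp: chow_rank_eq card_eq_0_iff)
  qed (auto simp: finite_FY)
  also have "\<dots> = (\<Sum>d\<in>size ` FY. \<Sum>m | m \<in> FY \<and> size m = d. t ^ size m)"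
    by (simp add: chow_rank_eq)
  also have "\<dots> = (\<Sum>m\<in>FY. t ^ size m)"
    using finite_FY by (intro sum.group) auto
  finally show ?thesis .
qed

end

theorem theorem5p2:
  fixes n r :: nat
  assumes "1 \<le> r" and "r \<le> n" and "odd r"
  shows "(-1) ^ ((r - 1) div 2) * real_of_int (chow_hilbert (uniform_flats n r) {} (-1))
       = (-1) ^ ((r - 1) div 2) * (\<Sum>k = 0..(r - 1) div 2. real (n choose (2 * k)) * secant_number (2 * k))"
proof -
  interpret uniform_matroid n r
    using assms by unfold_locales
  show ?thesis
    using FY_signed_count[OF assms(3)] by (simp add: chow_hilbert_eq)
qed

end
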